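(* Let $\mathcal{A}$ be an abelian category and $n$ a positive integer. The following hold both with all words in parentheses omitted and with all of them included. (1) Assume that $\mathcal{A}$ is AB3*, and let $M,N_1,\dots,N_n$ be objects of $\mathcal{A}$. Then $\bigoplus_{i=1}^n N_i$ is (strongly) $M$-CS-Baer if and only if $N_i$ is (strongly) $M$-CS-Baer for any $i\in\{1,\dots,n\}$. (2) Assume that $\mathcal{A}$ is AB3, and let $N,M_1,\dots,M_n$ be objects of $\mathcal{A}$. Then $N$ is dual (strongly) $\bigoplus_{i=1}^n M_i$-CS-Baer if and only if $N$ is dual (strongly) $M_i$-CS-Baer for any $i\in\{1,\dots,n\}$.
   Context: An abelian category is AB3 (AB3* ) if it has arbitrary coproducts (products); it then has arbitrary sums (intersections) of families of subobjects. A subobject $i:K\to M$ is fully invariant if for every $h:M\to M$ one has $hi=i\alpha$ for some $\alpha:K\to K$. A subobject $L$ of $N$ lies above a direct summand $K$ of $N$ if $K\subseteq L$ and $L/K$ is superfluous in $N/K$ (a subobject $A$ of $B$ is superfluous if $A+X=B$ implies $X=B$ for every subobject $X$ of $B$). In an AB3* abelian category, $N$ is (strongly) $M$-CS-Baer if for every family $(f_i)_{i\in I}$ of morphisms $f_i:M\to N$, $\bigcap_{i\in I}\mathrm{Ker}(f_i)$ is essential in a (fully invariant) direct summand of $M$. In an AB3 abelian category, $N$ is dual (strongly) $M$-CS-Baer if for every family $(f_i)_{i\in I}$ of morphisms $f_i:M\to N$, $\sum_{i\in I}\mathrm{Im}(f_i)$ lies above a (fully invariant) direct summand of $N$. *)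

theory Defs
  imports "HOL-Algebra.FiniteProduct"
begin

unbundle cardinal_syntax

section \<open>Abelian categories\<close>

text \<open>
  An arrow determines its domain and codomain, so addition needs no object arguments.
  All fields are only meaningful on objects in \<open>Ob\<close>, arrows in \<open>Ar\<close>, composable pairs
  (\<open>g \<cdot> f\<close> is ``\<open>g\<close> after \<open>f\<close>'') and parallel pairs, respectively.
\<close>

record ('o, 'a) additive_category_data =
  Ob   :: "'o set"
  Ar   :: "'a set"
  Dom  :: "'a \<Rightarrow> 'o"
  Cod  :: "'a \<Rightarrow> 'o"
  Idt  :: "'o \<Rightarrow> 'a"
  Comp :: "'a \<Rightarrow> 'a \<Rightarrow> 'a"  (infixl \<open>\<cdot>\<index>\<close> 75)
  Plus :: "'a \<Rightarrow> 'a \<Rightarrow> 'a"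
  Zero :: "'o \<Rightarrow> 'o \<Rightarrow> 'a"

definition arrows :: "('o, 'a) additive_category_data \<Rightarrow> 'o \<Rightarrow> 'o \<Rightarrow> 'a set" where
  "arrows C A B = {f \<in> Ar C. Dom C f = A \<and> Cod C f = B}"

definition arrow_group :: "('o, 'a) additive_category_data \<Rightarrow> 'o \<Rightarrow> 'o \<Rightarrow> 'a monoid" where
  "arrow_group C A B = \<lparr>carrier = arrows C A B, mult = Plus C, one = Zero C A B\<rparr>"

locale category =
  fixes C :: "('o, 'a) additive_category_data" (structure)
  assumes Dom_closed: "f \<in> Ar C \<Longrightarrow> Dom C f \<in> Ob C"
    and Cod_closed: "f \<in> Ar C \<Longrightarrow> Cod C f \<in> Ob C"
    and Idt_closed: "A \<in> Ob C \<Longrightarrow> Idt C A \<in> arrows C A A"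
    and Comp_closed: "\<lbrakk>f \<in> arrows C A B; g \<in> arrows C B D\<rbrakk> \<Longrightarrow> g \<cdot> f \<in> arrows C A D"
    and Idt_left: "f \<in> arrows C A B \<Longrightarrow> Idt C B \<cdot> f = f"
    and Idt_right: "f \<in> arrows C A B \<Longrightarrow> f \<cdot> Idt C A = f"
    and Comp_assoc: "\<lbrakk>f \<in> arrows C A B; g \<in> arrows C B D; h \<in> arrows C D E\<rbrakk>
      \<Longrightarrow> (h \<cdot> g) \<cdot> f = h \<cdot> (g \<cdot> f)"

locale preadditive_category = category +
  assumes arrow_group: "\<lbrakk>A \<in> Ob C; B \<in> Ob C\<rbrakk> \<Longrightarrow> comm_group (arrow_group C A B)"
    and Comp_Plus_left: "\<lbrakk>f \<in> arrows C A B; g \<in> arrows C B D; h \<in> arrows C B D\<rbrakk>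
      \<Longrightarrow> Plus C g h \<cdot> f = Plus C (g \<cdot> f) (h \<cdot> f)"
    and Comp_Plus_right: "\<lbrakk>f \<in> arrows C A B; g \<in> arrows C A B; h \<in> arrows C B D\<rbrakk>
      \<Longrightarrow> h \<cdot> Plus C f g = Plus C (h \<cdot> f) (h \<cdot> g)"

definition is_mono :: "('o, 'a) additive_category_data \<Rightarrow> 'a \<Rightarrow> bool" where
  "is_mono C m \<longleftrightarrow> m \<in> Ar C \<and>
     (\<forall>A. \<forall>g\<in>arrows C A (Dom C m). \<forall>h\<in>arrows C A (Dom C m).
        m \<cdot>\<^bsub>C\<^esub> g = m \<cdot>\<^bsub>C\<^esub> h \<longrightarrow> g = h)"

definition is_epi :: "('o, 'a) additive_category_data \<Rightarrow> 'a \<Rightarrow> bool" where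
  "is_epi C e \<longleftrightarrow> e \<in> Ar C \<and>
     (\<forall>B. \<forall>g\<in>arrows C (Cod C e) B. \<forall>h\<in>arrows C (Cod C e) B.
        g \<cdot>\<^bsub>C\<^esub> e = h \<cdot>\<^bsub>C\<^esub> e \<longrightarrow> g = h)"

definition is_zero_arrow :: "('o, 'a) additive_category_data \<Rightarrow> 'a \<Rightarrow> bool" where
  "is_zero_arrow C f \<longleftrightarrow> f \<in> Ar C \<and> f = Zero C (Dom C f) (Cod C f)"

definition is_kernel :: "('o, 'a) additive_category_data \<Rightarrow> 'a \<Rightarrow> 'a \<Rightarrow> bool" where
  "is_kernel C k f \<longleftrightarrow> f \<in> Ar C \<and> k \<in> Ar C \<and> Cod C k = Dom C f \<and> is_zero_arrow C (f \<cdot>\<^bsub>C\<^esub> k) \<and>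
     (\<forall>A. \<forall>h\<in>arrows C A (Dom C f). is_zero_arrow C (f \<cdot>\<^bsub>C\<^esub> h) \<longrightarrow>
        (\<exists>!u. u \<in> arrows C A (Dom C k) \<and> k \<cdot>\<^bsub>C\<^esub> u = h))"

definition is_cokernel :: "('o, 'a) additive_category_data \<Rightarrow> 'a \<Rightarrow> 'a \<Rightarrow> bool" where
  "is_cokernel C q f \<longleftrightarrow> f \<in> Ar C \<and> q \<in> Ar C \<and> Dom C q = Cod C f \<and> is_zero_arrow C (q \<cdot>\<^bsub>C\<^esub> f) \<and>
     (\<forall>B. \<forall>h\<in>arrows C (Cod C f) B. is_zero_arrow C (h \<cdot>\<^bsub>C\<^esub> f) \<longrightarrow>
        (\<exists>!u. u \<in> arrows C (Cod C q) B \<and> u \<cdot>\<^bsub>C\<^esub> q = h))"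

definition is_image :: "('o, 'a) additive_category_data \<Rightarrow> 'a \<Rightarrow> 'a \<Rightarrow> bool" where
  "is_image C m f \<longleftrightarrow> (\<exists>q. is_cokernel C q f \<and> is_kernel C m q)"

text \<open>
  \<open>is_direct_sum C I X S \<iota> \<pi>\<close>, for finite \<open>I\<close>: the object \<open>S\<close> with injections \<open>\<iota> i : X i \<rightarrow> S\<close> and
  projections \<open>\<pi> i : S \<rightarrow> X i\<close> is a biproduct of \<open>(X i)\<^sub>i\<^sub>\<in>\<^sub>I\<close>. The multiplicatively written
  \<open>finprod\<close> is the sum of the endomorphisms \<open>\<iota> i \<cdot> \<pi> i\<close> in the additive group of \<open>S \<rightarrow> S\<close>.
\<close>

definition is_direct_sum ::
    "('o, 'a) additive_category_data \<Rightarrow> 'i set \<Rightarrow> ('i \<Rightarrow> 'o) \<Rightarrow> 'o \<Rightarrow> ('i \<Rightarrow> 'a) \<Rightarrow> ('i \<Rightarrow> 'a) \<Rightarrow> bool" where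
  "is_direct_sum C I X S \<iota> \<pi> \<longleftrightarrow> finite I \<and> S \<in> Ob C \<and>
     (\<forall>i\<in>I. X i \<in> Ob C \<and> \<iota> i \<in> arrows C (X i) S \<and> \<pi> i \<in> arrows C S (X i)) \<and>
     (\<forall>i\<in>I. \<forall>j\<in>I. \<pi> j \<cdot>\<^bsub>C\<^esub> \<iota> i = (if i = j then Idt C (X i) else Zero C (X i) (X j))) \<and>
     finprod (arrow_group C S S) (\<lambda>i. \<iota> i \<cdot>\<^bsub>C\<^esub> \<pi> i) I = Idt C S"

text \<open>In \<open>finite_direct_sums\<close>, the case \<open>n = 0\<close> provides the zero object.\<close>

locale abelian_category = preadditive_category +
  assumes finite_direct_sums: "\<And>(n::nat) X. (\<forall>i\<in>{1..n}. X i \<in> Ob C) \<Longrightarrow>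
      \<exists>S \<iota> \<pi>. is_direct_sum C {1..n} X S \<iota> \<pi>"
    and kernels: "f \<in> Ar C \<Longrightarrow> \<exists>k. is_kernel C k f"
    and cokernels: "f \<in> Ar C \<Longrightarrow> \<exists>q. is_cokernel C q f"
    and mono_normal: "is_mono C m \<Longrightarrow> \<exists>f. is_kernel C m f"
    and epi_normal: "is_epi C e \<Longrightarrow> \<exists>f. is_cokernel C e f"

section \<open>Smallness, AB3 and AB3*\<close>

text \<open>
  ``Arbitrary'' (co)products are indexed by small sets; (co)products indexed by all sets of arrows
  would force the category to be trivial. A cardinal \<open>\<kappa>\<close> fixes the meaning of small: a set is
  small if it has fewer than \<open>\<kappa>\<close> elements. The usual convention is the case where \<open>\<kappa>\<close> is the
  cardinality of a universe. Every cardinal less than \<open>\<kappa> :: 'u rel\<close> is that of some set of type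
  \<open>'u set\<close>, so index sets may be taken of this type.
\<close>

definition small :: "'u rel \<Rightarrow> 'b set \<Rightarrow> bool" where
  "small \<kappa> I \<longleftrightarrow> |I| <o \<kappa>"

definition locally_small :: "'u rel \<Rightarrow> ('o, 'a) additive_category_data \<Rightarrow> bool" where
  "locally_small \<kappa> C \<longleftrightarrow> (\<forall>A\<in>Ob C. \<forall>B\<in>Ob C. small \<kappa> (arrows C A B))"

definition is_product ::
    "('o, 'a) additive_category_data \<Rightarrow> 'i set \<Rightarrow> ('i \<Rightarrow> 'o) \<Rightarrow> 'o \<Rightarrow> ('i \<Rightarrow> 'a) \<Rightarrow> bool" where
  "is_product C I X P \<pi> \<longleftrightarrow> P \<in> Ob C \<and> (\<forall>i\<in>I. \<pi> i \<in> arrows C P (X i)) \<and>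
     (\<forall>Y\<in>Ob C. \<forall>f. (\<forall>i\<in>I. f i \<in> arrows C Y (X i)) \<longrightarrow>
        (\<exists>!u. u \<in> arrows C Y P \<and> (\<forall>i\<in>I. \<pi> i \<cdot>\<^bsub>C\<^esub> u = f i)))"

definition is_coproduct ::
    "('o, 'a) additive_category_data \<Rightarrow> 'i set \<Rightarrow> ('i \<Rightarrow> 'o) \<Rightarrow> 'o \<Rightarrow> ('i \<Rightarrow> 'a) \<Rightarrow> bool" where
  "is_coproduct C I X S \<iota> \<longleftrightarrow> S \<in> Ob C \<and> (\<forall>i\<in>I. \<iota> i \<in> arrows C (X i) S) \<and>
     (\<forall>Y\<in>Ob C. \<forall>f. (\<forall>i\<in>I. f i \<in> arrows C (X i) Y) \<longrightarrow>
        (\<exists>!u. u \<in> arrows C S Y \<and> (\<forall>i\<in>I. u \<cdot>\<^bsub>C\<^esub> \<iota> i = f i)))"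

definition AB3 :: "'u rel \<Rightarrow> ('o, 'a) additive_category_data \<Rightarrow> bool" where
  "AB3 \<kappa> C \<longleftrightarrow> (\<forall>(I :: 'u set) X. small \<kappa> I \<and> (\<forall>i\<in>I. X i \<in> Ob C) \<longrightarrow> (\<exists>S \<iota>. is_coproduct C I X S \<iota>))"

definition AB3_star :: "'u rel \<Rightarrow> ('o, 'a) additive_category_data \<Rightarrow> bool" where
  "AB3_star \<kappa> C \<longleftrightarrow> (\<forall>(I :: 'u set) X. small \<kappa> I \<and> (\<forall>i\<in>I. X i \<in> Ob C) \<longrightarrow> (\<exists>P \<pi>. is_product C I X P \<pi>))"

section \<open>Subobjects\<close>

text \<open>
  Subobjects are represented by monomorphisms, so kernels, images, intersections and sums are
  determined only up to isomorphism; all notions below are invariant under it.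
\<close>

definition is_subobject :: "('o, 'a) additive_category_data \<Rightarrow> 'o \<Rightarrow> 'a \<Rightarrow> bool" where
  "is_subobject C M k \<longleftrightarrow> is_mono C k \<and> Cod C k = M"

definition subobject_le :: "('o, 'a) additive_category_data \<Rightarrow> 'a \<Rightarrow> 'a \<Rightarrow> bool" where
  "subobject_le C k l \<longleftrightarrow> (\<exists>u\<in>arrows C (Dom C k) (Dom C l). l \<cdot>\<^bsub>C\<^esub> u = k)"

definition is_intersection :: "('o, 'a) additive_category_data \<Rightarrow> 'o \<Rightarrow> 'a set \<Rightarrow> 'a \<Rightarrow> bool" where
  "is_intersection C M \<S> m \<longleftrightarrow> is_subobject C M m \<and> (\<forall>k\<in>\<S>. subobject_le C m k) \<and>
     (\<forall>x. is_subobject C M x \<and> (\<forall>k\<in>\<S>. subobject_le C x k) \<longrightarrow> subobject_le C x m)"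

definition is_subobject_sum :: "('o, 'a) additive_category_data \<Rightarrow> 'o \<Rightarrow> 'a set \<Rightarrow> 'a \<Rightarrow> bool" where
  "is_subobject_sum C M \<S> m \<longleftrightarrow> is_subobject C M m \<and> (\<forall>k\<in>\<S>. subobject_le C k m) \<and>
     (\<forall>x. is_subobject C M x \<and> (\<forall>k\<in>\<S>. subobject_le C k x) \<longrightarrow> subobject_le C m x)"

text \<open>\<open>a : A \<rightarrow> B\<close> is essential if \<open>A \<inter> X = 0\<close> implies \<open>X = 0\<close>, for every subobject \<open>X\<close> of \<open>B\<close>.\<close>

definition is_essential :: "('o, 'a) additive_category_data \<Rightarrow> 'a \<Rightarrow> bool" where
  "is_essential C a \<longleftrightarrow> is_mono C a \<and>
     (\<forall>x. is_subobject C (Cod C a) x \<and>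
          (\<exists>z. is_intersection C (Cod C a) {a, x} z \<and> is_zero_arrow C z) \<longrightarrow> is_zero_arrow C x)"

text \<open>\<open>a : A \<rightarrow> B\<close> is superfluous if \<open>A + X = B\<close> implies \<open>X = B\<close>, for every subobject \<open>X\<close> of \<open>B\<close>.\<close>

definition is_superfluous :: "('o, 'a) additive_category_data \<Rightarrow> 'a \<Rightarrow> bool" where
  "is_superfluous C a \<longleftrightarrow> is_mono C a \<and>
     (\<forall>x. is_subobject C (Cod C a) x \<and> is_subobject_sum C (Cod C a) {a, x} (Idt C (Cod C a))
          \<longrightarrow> subobject_le C (Idt C (Cod C a)) x)"

definition essential_in :: "('o, 'a) additive_category_data \<Rightarrow> 'a \<Rightarrow> 'a \<Rightarrow> bool" where
  "essential_in C k d \<longleftrightarrow>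
     (\<exists>u\<in>arrows C (Dom C k) (Dom C d). d \<cdot>\<^bsub>C\<^esub> u = k \<and> is_essential C u)"

text \<open>
  For \<open>k : K \<rightarrow> N\<close> and \<open>l : L \<rightarrow> N\<close> with \<open>K \<subseteq> L\<close> via \<open>u : K \<rightarrow> L\<close>: \<open>q : N \<rightarrow> N/K\<close> and \<open>p : L \<rightarrow> L/K\<close> are
  the quotients and \<open>j : L/K \<rightarrow> N/K\<close> is the induced inclusion.
\<close>

definition lies_above :: "('o, 'a) additive_category_data \<Rightarrow> 'a \<Rightarrow> 'a \<Rightarrow> bool" where
  "lies_above C l k \<longleftrightarrow>
     (\<exists>u\<in>arrows C (Dom C k) (Dom C l). l \<cdot>\<^bsub>C\<^esub> u = k \<and>
       (\<exists>q p. is_cokernel C q k \<and> is_cokernel C p u \<and>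
         (\<exists>j\<in>arrows C (Cod C p) (Cod C q). j \<cdot>\<^bsub>C\<^esub> p = q \<cdot>\<^bsub>C\<^esub> l \<and> is_superfluous C j)))"

definition is_direct_summand :: "('o, 'a) additive_category_data \<Rightarrow> 'o \<Rightarrow> 'a \<Rightarrow> bool" where
  "is_direct_summand C M d \<longleftrightarrow>
     (\<exists>X \<iota> \<pi>. is_direct_sum C {1..2::nat} X M \<iota> \<pi> \<and> \<iota> 1 = d)"

definition is_fully_invariant :: "('o, 'a) additive_category_data \<Rightarrow> 'o \<Rightarrow> 'a \<Rightarrow> bool" where
  "is_fully_invariant C M i \<longleftrightarrow> is_subobject C M i \<and>
     (\<forall>h\<in>arrows C M M. \<exists>\<alpha>\<in>arrows C (Dom C i) (Dom C i). h \<cdot>\<^bsub>C\<^esub> i = i \<cdot>\<^bsub>C\<^esub> \<alpha>)"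

section \<open>CS-Baer objects and their duals\<close>

text \<open>
  The argument order follows the phrase ``\<open>N\<close> is \<open>M\<close>-CS-Baer'': \<open>CS_Baer \<kappa> C M N\<close>, and similarly
  for the other three notions; in all of them the morphisms go from \<open>M\<close> to \<open>N\<close>.
\<close>

definition CS_Baer :: "'u rel \<Rightarrow> ('o, 'a) additive_category_data \<Rightarrow> 'o \<Rightarrow> 'o \<Rightarrow> bool" where
  "CS_Baer \<kappa> C M N \<longleftrightarrow>
     (\<forall>(I :: 'u set) f. small \<kappa> I \<and> (\<forall>i\<in>I. f i \<in> arrows C M N) \<longrightarrow>
        (\<exists>m d. is_intersection C M {k. \<exists>i\<in>I. is_kernel C k (f i)} m \<and>
           is_direct_summand C M d \<and> essential_in C m d))"

definition strongly_CS_Baer :: "'u rel \<Rightarrow> ('o, 'a) additive_category_data \<Rightarrow> 'o \<Rightarrow> 'o \<Rightarrow> bool" where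
  "strongly_CS_Baer \<kappa> C M N \<longleftrightarrow>
     (\<forall>(I :: 'u set) f. small \<kappa> I \<and> (\<forall>i\<in>I. f i \<in> arrows C M N) \<longrightarrow>
        (\<exists>m d. is_intersection C M {k. \<exists>i\<in>I. is_kernel C k (f i)} m \<and>
           is_direct_summand C M d \<and> is_fully_invariant C M d \<and> essential_in C m d))"

definition dual_CS_Baer :: "'u rel \<Rightarrow> ('o, 'a) additive_category_data \<Rightarrow> 'o \<Rightarrow> 'o \<Rightarrow> bool" where
  "dual_CS_Baer \<kappa> C M N \<longleftrightarrow>
     (\<forall>(I :: 'u set) f. small \<kappa> I \<and> (\<forall>i\<in>I. f i \<in> arrows C M N) \<longrightarrow>
        (\<exists>l d. is_subobject_sum C N {m. \<exists>i\<in>I. is_image C m (f i)} l \<and>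
           is_direct_summand C N d \<and> lies_above C l d))"

definition dual_strongly_CS_Baer :: "'u rel \<Rightarrow> ('o, 'a) additive_category_data \<Rightarrow> 'o \<Rightarrow> 'o \<Rightarrow> bool" where
  "dual_strongly_CS_Baer \<kappa> C M N \<longleftrightarrow>
     (\<forall>(I :: 'u set) f. small \<kappa> I \<and> (\<forall>i\<in>I. f i \<in> arrows C M N) \<longrightarrow>
        (\<exists>l d. is_subobject_sum C N {m. \<exists>i\<in>I. is_image C m (f i)} l \<and>
           is_direct_summand C N d \<and> is_fully_invariant C N d \<and> lies_above C l d))"

end

theory Submission
  imports Defs
begin

text \<open>
  A direct summand is replaced by the idempotent projecting onto it, so that being CS-Baer says:
  for every small family of arrows \<open>f\<^sub>j : M \<rightarrow> N\<close> there is an idempotent \<open>e\<close> of \<open>M\<close> whose image contains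
  the common kernel of the \<open>f\<^sub>j\<close> as an essential subobject. If \<open>e\<^sub>2\<close> works for \<open>(g\<^sub>j)\<close> with common
  kernel \<open>K\<^sub>2\<close> and \<open>(f\<^sub>j)\<close> is a second family with common kernel \<open>K\<^sub>1\<close>, apply the hypothesis to the
  family \<open>(f\<^sub>j e\<^sub>2)\<close> rather than to \<open>(f\<^sub>j)\<close>: its common kernel is \<open>(K\<^sub>1 \<inter> e\<^sub>2 M) \<oplus> (1 - e\<^sub>2) M\<close>, and the
  resulting idempotent \<open>e\<close> fixes \<open>1 - e\<^sub>2\<close>. This makes \<open>e\<^sub>2 e\<close> an idempotent with image
  \<open>e\<^sub>2 M \<inter> e M\<close>, in which \<open>K\<^sub>1 \<inter> K\<^sub>2\<close> is essential, and it is fully invariant if \<open>e\<close> and \<open>e\<^sub>2\<close> are.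
  Since the kernel of an arrow into a direct sum is the intersection of the kernels of its components,
  induction on the number of summands gives part (1). For part (2), a subobject
  of \<open>N\<close> is replaced by its quotient and a direct summand by the complementary idempotent; then the
  dual notion is the original one in the opposite category.
\<close>

section \<open>Categories and preadditive categories\<close>

context category
begin

lemma in_arrows_iff [simp]: "f \<in> arrows C A B \<longleftrightarrow> f \<in> Ar C \<and> Dom C f = A \<and> Cod C f = B"
  by (auto simp: arrows_def)

lemma comp_closed [simp]:
  assumes "f \<in> Ar C" "g \<in> Ar C" "Cod C f = Dom C g"
  shows "g \<cdot> f \<in> Ar C" "Dom C (g \<cdot> f) = Dom C f" "Cod C (g \<cdot> f) = Cod C g"
  using Comp_closed[of f "Dom C f" "Dom C g" g "Cod C g"] assms by auto

lemma idt_closed [simp]: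
  assumes "A \<in> Ob C"
  shows "Idt C A \<in> Ar C" "Dom C (Idt C A) = A" "Cod C (Idt C A) = A"
  using Idt_closed[OF assms] by auto

lemma comp_idt [simp]:
  "f \<in> Ar C \<Longrightarrow> Cod C f = A \<Longrightarrow> Idt C A \<cdot> f = f"
  "f \<in> Ar C \<Longrightarrow> Dom C f = A \<Longrightarrow> f \<cdot> Idt C A = f"
  using Idt_left[of f "Dom C f" A] Idt_right[of f A "Cod C f"] by auto

lemma comp_assoc [simp]:
  assumes "f \<in> Ar C" "g \<in> Ar C" "h \<in> Ar C" "Cod C f = Dom C g" "Cod C g = Dom C h"
  shows "(h \<cdot> g) \<cdot> f = h \<cdot> (g \<cdot> f)"
  using Comp_assoc[of f "Dom C f" "Dom C g" g "Dom C h" h "Cod C h"] assms by auto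

lemma comp_cong_left:
  assumes "h \<cdot> g = k" "f \<in> Ar C" "g \<in> Ar C" "h \<in> Ar C" "Cod C f = Dom C g" "Cod C g = Dom C h"
  shows "h \<cdot> (g \<cdot> f) = k \<cdot> f"
  using assms comp_assoc by metis

lemma dom_cod_ob [simp]: "f \<in> Ar C \<Longrightarrow> Dom C f \<in> Ob C" "f \<in> Ar C \<Longrightarrow> Cod C f \<in> Ob C"
  by (auto intro: Dom_closed Cod_closed)

lemma mono_ar [simp]: "is_mono C m \<Longrightarrow> m \<in> Ar C"
  by (simp add: is_mono_def)

lemma epi_ar [simp]: "is_epi C m \<Longrightarrow> m \<in> Ar C"
  by (simp add: is_epi_def)

lemma mono_cancel:
  assumes "is_mono C m" "m \<cdot> g = m \<cdot> h" "g \<in> Ar C" "h \<in> Ar C"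
    "Cod C g = Dom C m" "Cod C h = Dom C m" "Dom C g = Dom C h"
  shows "g = h"
  using assms unfolding is_mono_def by auto

lemma mono_factor:
  assumes "is_mono C (g \<cdot> f)" "f \<in> Ar C" "g \<in> Ar C" "Cod C f = Dom C g"
  shows "is_mono C f"
  unfolding is_mono_def
proof (intro conjI allI ballI impI)
  fix A a b assume *: "a \<in> arrows C A (Dom C f)" "b \<in> arrows C A (Dom C f)" "f \<cdot> a = f \<cdot> b"
  show "a = b"
    by (rule mono_cancel[OF assms(1)]) (use assms * in auto)
qed (use assms in auto)

lemma mono_comp:
  assumes "is_mono C f" "is_mono C g" "Cod C f = Dom C g"
  shows "is_mono C (g \<cdot> f)"
  unfolding is_mono_def
proof (intro conjI allI ballI impI)
  fix A a b assume *: "a \<in> arrows C A (Dom C (g \<cdot> f))" "b \<in> arrows C A (Dom C (g \<cdot> f))"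
    "(g \<cdot> f) \<cdot> a = (g \<cdot> f) \<cdot> b"
  have "f \<cdot> a = f \<cdot> b"
    by (rule mono_cancel[OF assms(2)]) (use assms * in auto)
  show "a = b"
    by (rule mono_cancel[OF assms(1) \<open>f \<cdot> a = f \<cdot> b\<close>]) (use assms * in auto)
qed (use assms in auto)

lemma mono_idt: "A \<in> Ob C \<Longrightarrow> is_mono C (Idt C A)"
  unfolding is_mono_def by auto

lemma split_mono:
  assumes "r \<cdot> s = Idt C (Dom C s)" "r \<in> Ar C" "s \<in> Ar C" "Cod C s = Dom C r"
  shows "is_mono C s"
  by (rule mono_factor[of r]) (use assms in \<open>auto simp: mono_idt\<close>)

lemma subobject_leE:
  assumes "subobject_le C k l"
  obtains u where "u \<in> Ar C" "Dom C u = Dom C k" "Cod C u = Dom C l" "l \<cdot> u = k"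
  using assms unfolding subobject_le_def by auto

lemma subobject_leI:
  assumes "u \<in> Ar C" "l \<in> Ar C" "Cod C u = Dom C l"
  shows "subobject_le C (l \<cdot> u) l"
  using assms unfolding subobject_le_def by auto

lemma subobject_le_trans:
  assumes "subobject_le C j k" "subobject_le C k l" "l \<in> Ar C"
  shows "subobject_le C j l"
proof -
  obtain u where u: "u \<in> Ar C" "Dom C u = Dom C j" "Cod C u = Dom C k" "k \<cdot> u = j"
    using assms(1) by (rule subobject_leE)
  obtain v where v: "v \<in> Ar C" "Dom C v = Dom C k" "Cod C v = Dom C l" "l \<cdot> v = k"
    using assms(2) by (rule subobject_leE)
  have "l \<cdot> (v \<cdot> u) = j" using comp_cong_left[of l v k u] u v assms(3) by simp
  then show ?thesis using subobject_leI[of "v \<cdot> u" l] u v assms(3) by simp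
qed

end

section \<open>Arithmetic of arrows: differences, zero arrows, kernels and cokernels\<close>

context preadditive_category
begin

lemma zero_closed [simp]:
  assumes "A \<in> Ob C" "B \<in> Ob C"
  shows "Zero C A B \<in> Ar C" "Dom C (Zero C A B) = A" "Cod C (Zero C A B) = B"
  using monoid.one_closed[OF comm_monoid.axioms(1)[OF comm_group.axioms(1)[OF arrow_group[OF assms]]]]
  by (auto simp: arrow_group_def)

lemma plus_closed [simp]:
  assumes "f \<in> Ar C" "g \<in> Ar C" "Dom C f = Dom C g" "Cod C f = Cod C g"
  shows "Plus C f g \<in> Ar C" "Dom C (Plus C f g) = Dom C g" "Cod C (Plus C f g) = Cod C g"
proof -
  interpret G: comm_group "arrow_group C (Dom C g) (Cod C g)"
    by (rule arrow_group) (use assms in auto)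
  show "Plus C f g \<in> Ar C" "Dom C (Plus C f g) = Dom C g" "Cod C (Plus C f g) = Cod C g"
    using G.m_closed[of f g] assms by (auto simp: arrow_group_def)
qed

lemma zero_is_zero [simp]: "A \<in> Ob C \<Longrightarrow> B \<in> Ob C \<Longrightarrow> is_zero_arrow C (Zero C A B)"
  by (simp add: is_zero_arrow_def)

lemma zero_arrow_ar: "is_zero_arrow C f \<Longrightarrow> f \<in> Ar C"
  by (simp add: is_zero_arrow_def)

lemma zero_arrow_unique:
  "\<lbrakk>is_zero_arrow C f; is_zero_arrow C g; Dom C f = Dom C g; Cod C f = Cod C g\<rbrakk> \<Longrightarrow> f = g"
  unfolding is_zero_arrow_def by metis

lemma plus_zero [simp]:
  assumes "is_zero_arrow C z" "f \<in> Ar C" "Dom C f = Dom C z" "Cod C f = Cod C z"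
  shows "Plus C z f = f" "Plus C f z = f"
proof -
  have [simp]: "z \<in> Ar C" using assms(1) by (rule zero_arrow_ar)
  interpret G: comm_group "arrow_group C (Dom C z) (Cod C z)"
    by (rule arrow_group) (use assms in auto)
  have "z = one (arrow_group C (Dom C z) (Cod C z))"
    using assms by (simp add: arrow_group_def is_zero_arrow_def)
  then show "Plus C z f = f" "Plus C f z = f"
    using G.l_one[of f] G.r_one[of f] assms by (auto simp: arrow_group_def)
qed

lemma plus_commute:
  assumes "f \<in> Ar C" "g \<in> Ar C" "Dom C f = Dom C g" "Cod C f = Cod C g"
  shows "Plus C f g = Plus C g f"
proof -
  interpret G: comm_group "arrow_group C (Dom C g) (Cod C g)"
    by (rule arrow_group) (use assms in auto)
  show ?thesis
    using G.m_comm[of f g] assms by (auto simp: arrow_group_def)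
qed

lemma plus_left_cancel:
  assumes "Plus C f g = Plus C f h" "f \<in> Ar C" "g \<in> Ar C" "h \<in> Ar C"
    "Dom C f = Dom C g" "Cod C f = Cod C g" "Dom C f = Dom C h" "Cod C f = Cod C h"
  shows "g = h"
proof -
  interpret G: comm_group "arrow_group C (Dom C f) (Cod C f)"
    by (rule arrow_group) (use assms in auto)
  show ?thesis
    using G.Units_l_cancel[of f g h] assms unfolding G.Units_eq by (auto simp: arrow_group_def)
qed

lemma plus_right_cancel:
  assumes "Plus C g f = Plus C h f" "f \<in> Ar C" "g \<in> Ar C" "h \<in> Ar C"
    "Dom C f = Dom C g" "Cod C f = Cod C g" "Dom C f = Dom C h" "Cod C f = Cod C h"
  shows "g = h"
  by (rule plus_left_cancel[of f]) (use assms plus_commute[of f g] plus_commute[of f h] in auto)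

text \<open>Cancellation in the group of arrows. Most vanishing statements below are obtained by
  expanding one arrow in two ways and comparing through this fact.\<close>

lemma plus_eq_self_imp_zero:
  assumes "Plus C f g = f" "f \<in> Ar C" "g \<in> Ar C" "Dom C f = Dom C g" "Cod C f = Cod C g"
  shows "is_zero_arrow C g"
proof -
  have "g = Zero C (Dom C f) (Cod C f)"
    by (rule plus_left_cancel[of f]) (use assms in auto)
  then show ?thesis using assms by (metis zero_is_zero dom_cod_ob)
qed

text \<open>The category data carry no negation, so a difference is produced as a witness from the
  group inverse. Every complement \<open>1 - e\<close> of an idempotent below arises in this
  way.\<close>

lemma ex_difference:
  assumes "f \<in> Ar C" "h \<in> Ar C" "Dom C f = Dom C h" "Cod C f = Cod C h"
  obtains g where "g \<in> Ar C" "Dom C g = Dom C f" "Cod C g = Cod C f" "Plus C f g = h"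
proof -
  interpret G: comm_group "arrow_group C (Dom C f) (Cod C f)"
    by (rule arrow_group) (use assms in auto)
  have f: "f \<in> carrier (arrow_group C (Dom C f) (Cod C f))"
    and h: "h \<in> carrier (arrow_group C (Dom C f) (Cod C f))"
    using assms by (auto simp: arrow_group_def)
  then obtain g where "g \<in> carrier (arrow_group C (Dom C f) (Cod C f))"
    "f \<otimes>\<^bsub>arrow_group C (Dom C f) (Cod C f)\<^esub> g = h"
    by (metis G.inv_solve_left G.inv_closed G.m_closed)
  then show thesis
    by (intro that[of g]) (auto simp: arrow_group_def)
qed

lemma comp_plus_left [simp]:
  assumes "f \<in> Ar C" "g \<in> Ar C" "h \<in> Ar C" "Cod C f = Dom C g" "Dom C g = Dom C h" "Cod C g = Cod C h"
  shows "Plus C g h \<cdot> f = Plus C (g \<cdot> f) (h \<cdot> f)"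
  using Comp_Plus_left[of f "Dom C f" "Dom C g" g "Cod C g" h] assms by auto

lemma comp_plus_right [simp]:
  assumes "f \<in> Ar C" "g \<in> Ar C" "h \<in> Ar C" "Cod C f = Dom C h" "Dom C g = Dom C f" "Cod C g = Cod C f"
  shows "h \<cdot> Plus C f g = Plus C (h \<cdot> f) (h \<cdot> g)"
  using Comp_Plus_right[of f "Dom C f" "Dom C h" g h "Cod C h"] assms by auto

lemma comp_zero_right [simp]:
  assumes "is_zero_arrow C z" "g \<in> Ar C" "Cod C z = Dom C g"
  shows "is_zero_arrow C (g \<cdot> z)"
proof -
  have [simp]: "z \<in> Ar C" using assms(1) by (rule zero_arrow_ar)
  have "g \<cdot> z = g \<cdot> Plus C z z" using assms by (simp del: comp_plus_right)
  also have "\<dots> = Plus C (g \<cdot> z) (g \<cdot> z)" using assms by (intro comp_plus_right) auto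
  finally have "Plus C (g \<cdot> z) (g \<cdot> z) = g \<cdot> z" ..
  from plus_eq_self_imp_zero[OF this] show ?thesis using assms by auto
qed

lemma comp_zero_left [simp]:
  assumes "is_zero_arrow C z" "g \<in> Ar C" "Cod C g = Dom C z"
  shows "is_zero_arrow C (z \<cdot> g)"
proof -
  have [simp]: "z \<in> Ar C" using assms(1) by (rule zero_arrow_ar)
  have "z \<cdot> g = Plus C z z \<cdot> g" using assms by (simp del: comp_plus_left)
  also have "\<dots> = Plus C (z \<cdot> g) (z \<cdot> g)" using assms by (intro comp_plus_left) auto
  finally have "Plus C (z \<cdot> g) (z \<cdot> g) = z \<cdot> g" ..
  from plus_eq_self_imp_zero[OF this] show ?thesis using assms by auto
qed

lemma comp_zero_left_assoc:
  assumes "is_zero_arrow C (h \<cdot> g)" "f \<in> Ar C" "g \<in> Ar C" "h \<in> Ar C" "Cod C f = Dom C g" "Cod C g = Dom C h"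
  shows "is_zero_arrow C (h \<cdot> (g \<cdot> f))"
  using comp_zero_left[OF assms(1), of f] assms by simp

lemma mono_zero:
  assumes "is_mono C m" "is_zero_arrow C (m \<cdot> g)" "g \<in> Ar C" "Cod C g = Dom C m"
  shows "is_zero_arrow C g"
proof -
  have "g = Zero C (Dom C g) (Cod C g)"
  proof (rule mono_cancel[OF assms(1)])
    show "m \<cdot> g = m \<cdot> Zero C (Dom C g) (Cod C g)"
      by (rule zero_arrow_unique) (use assms in auto)
  qed (use assms in auto)
  then show ?thesis unfolding is_zero_arrow_def using assms by simp
qed

lemma epi_zero:
  assumes "is_epi C e" "is_zero_arrow C (g \<cdot> e)" "g \<in> Ar C" "Dom C g = Cod C e"
  shows "is_zero_arrow C g"
proof -
  have "g \<cdot> e = Zero C (Dom C g) (Cod C g) \<cdot> e"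
    by (rule zero_arrow_unique) (use assms in auto)
  with assms have "g = Zero C (Dom C g) (Cod C g)"
    unfolding is_epi_def by auto
  then show ?thesis unfolding is_zero_arrow_def using assms by simp
qed

text \<open>Two arrows identified by \<open>m\<close> differ by an arrow that \<open>m\<close>
  kills, so it is enough to test against zero.\<close>

lemma monoI_zero:
  assumes "m \<in> Ar C"
    and "\<And>g. \<lbrakk>g \<in> Ar C; Cod C g = Dom C m; is_zero_arrow C (m \<cdot> g)\<rbrakk> \<Longrightarrow> is_zero_arrow C g"
  shows "is_mono C m"
  unfolding is_mono_def
proof (intro conjI allI ballI impI)
  fix A a b assume *: "a \<in> arrows C A (Dom C m)" "b \<in> arrows C A (Dom C m)" "m \<cdot> a = m \<cdot> b"
  then obtain d where d: "d \<in> Ar C" "Dom C d = A" "Cod C d = Dom C m" "Plus C a d = b"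
    using ex_difference[of a b] by auto
  have "Plus C (m \<cdot> a) (m \<cdot> d) = m \<cdot> Plus C a d"
    using d(1-3) * assms(1) by simp
  also have "\<dots> = m \<cdot> a" using d * by simp
  finally have "is_zero_arrow C (m \<cdot> d)"
    by (rule plus_eq_self_imp_zero) (use d(1-3) *(1,2) assms(1) in auto)
  then have "is_zero_arrow C d" using assms(2)[of d] d * by auto
  with d * show "a = b" by auto
qed (use assms(1) in auto)

text \<open>This is how a subobject is shown to be the whole object: it is the kernel of some arrow,
  and that arrow is shown to vanish.\<close>

lemma idt_le_kernel_of_zero:
  assumes "is_zero_arrow C f" "is_kernel C k f"
  shows "subobject_le C (Idt C (Cod C k)) k"
proof -
  have "\<exists>u. u \<in> arrows C (Dom C f) (Dom C k) \<and> k \<cdot> u = Idt C (Dom C f)"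
    using assms unfolding is_kernel_def by (metis comp_idt(2) idt_closed in_arrows_iff dom_cod_ob(1))
  then show ?thesis using assms unfolding subobject_le_def is_kernel_def by auto
qed

lemma kernelD:
  assumes "is_kernel C k f"
  shows "f \<in> Ar C" "k \<in> Ar C" "Cod C k = Dom C f" "is_zero_arrow C (f \<cdot> k)"
  using assms unfolding is_kernel_def by auto

lemma cokernelD:
  assumes "is_cokernel C q f"
  shows "f \<in> Ar C" "q \<in> Ar C" "Dom C q = Cod C f" "is_zero_arrow C (q \<cdot> f)"
  using assms unfolding is_cokernel_def by auto

lemma kernel_universal:
  assumes "is_kernel C k f" "h \<in> Ar C" "Cod C h = Dom C f" "is_zero_arrow C (f \<cdot> h)"
  shows "subobject_le C h k"
  using assms unfolding is_kernel_def subobject_le_def by (metis in_arrows_iff)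

lemma cokernel_universal:
  assumes "is_cokernel C q f" "h \<in> Ar C" "Dom C h = Cod C f" "is_zero_arrow C (h \<cdot> f)"
  obtains u where "u \<in> Ar C" "Dom C u = Cod C q" "Cod C u = Cod C h" "u \<cdot> q = h"
  using assms unfolding is_cokernel_def by (metis in_arrows_iff)

lemma kernel_mono:
  assumes "is_kernel C k f"
  shows "is_mono C k"
  unfolding is_mono_def
proof (intro conjI allI ballI impI)
  fix A a b assume *: "a \<in> arrows C A (Dom C k)" "b \<in> arrows C A (Dom C k)" "k \<cdot> a = k \<cdot> b"
  note k = kernelD[OF assms]
  have "is_zero_arrow C (f \<cdot> (k \<cdot> a))"
    using k * comp_zero_left[OF k(4), of a] by auto
  then have "\<exists>!u. u \<in> arrows C A (Dom C k) \<and> k \<cdot> u = k \<cdot> a"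
    using assms k * unfolding is_kernel_def by auto
  then show "a = b" using * by metis
qed (use kernelD[OF assms] in auto)

lemma cokernel_epi:
  assumes "is_cokernel C q f"
  shows "is_epi C q"
  unfolding is_epi_def
proof (intro conjI allI ballI impI)
  fix A a b assume *: "a \<in> arrows C (Cod C q) A" "b \<in> arrows C (Cod C q) A" "a \<cdot> q = b \<cdot> q"
  note q = cokernelD[OF assms]
  have "is_zero_arrow C ((a \<cdot> q) \<cdot> f)"
    using q * comp_zero_right[OF q(4), of a] by auto
  then have "\<exists>!u. u \<in> arrows C (Cod C q) A \<and> u \<cdot> q = a \<cdot> q"
    using assms q * unfolding is_cokernel_def by auto
  then show "a = b" using * by metis
qed (use cokernelD[OF assms] in auto)

end

section \<open>Images, intersections and split idempotents\<close>

context abelian_category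
begin

text \<open>That \<open>b\<close> is an epimorphism is never needed; all that matters is that \<open>m\<close> has no more relations than \<open>h\<close>.\<close>

lemma image_factorization:
  assumes "h \<in> Ar C"
  obtains m b where "is_mono C m" "Cod C m = Cod C h" "b \<in> Ar C" "Dom C b = Dom C h" "Cod C b = Dom C m"
    "m \<cdot> b = h" "\<forall>w\<in>Ar C. Dom C w = Cod C h \<and> is_zero_arrow C (w \<cdot> h) \<longrightarrow> is_zero_arrow C (w \<cdot> m)"
proof -
  obtain q where q: "is_cokernel C q h" using cokernels[OF assms] by blast
  note q' = cokernelD[OF q]
  obtain m where m: "is_kernel C m q" using kernels[OF q'(2)] by blast
  note m' = kernelD[OF m]
  have "subobject_le C h m"
    by (rule kernel_universal[OF m assms _ q'(4)]) (use q' in simp)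
  then obtain b where b: "b \<in> Ar C" "Dom C b = Dom C h" "Cod C b = Dom C m" "m \<cdot> b = h"
    by (rule subobject_leE)
  show thesis
  proof (rule that[OF kernel_mono[OF m] _ b])
    show "\<forall>w\<in>Ar C. Dom C w = Cod C h \<and> is_zero_arrow C (w \<cdot> h) \<longrightarrow> is_zero_arrow C (w \<cdot> m)"
    proof (intro ballI impI, elim conjE)
      fix w assume w: "w \<in> Ar C" "Dom C w = Cod C h" "is_zero_arrow C (w \<cdot> h)"
      then obtain u where u: "u \<in> Ar C" "Dom C u = Cod C q" "Cod C u = Cod C w" "u \<cdot> q = w"
        by (rule cokernel_universal[OF q])
      have "is_zero_arrow C (u \<cdot> (q \<cdot> m))" using u m' by simp
      then show "is_zero_arrow C (w \<cdot> m)" using comp_cong_left[of u q w m] u m' by simp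
    qed
  qed (use m' q' in auto)
qed

text \<open>Monomorphisms are normal, so \<open>k\<close> is the kernel of some \<open>w\<close>. As
  \<open>h\<close> factors through \<open>k\<close>, \<open>w\<close> kills \<open>h\<close>; by the
  hypothesis on relations \<open>w\<close> then kills \<open>m\<close>, so \<open>m\<close> factors
  through the kernel of \<open>w\<close>.\<close>

lemma image_le:
  assumes "is_mono C k" "subobject_le C h k" "m \<in> Ar C" "Cod C m = Cod C h" "h \<in> Ar C"
    and im: "\<forall>w\<in>Ar C. Dom C w = Cod C h \<and> is_zero_arrow C (w \<cdot> h) \<longrightarrow> is_zero_arrow C (w \<cdot> m)"
  shows "subobject_le C m k"
proof -
  obtain w where w: "is_kernel C k w" using mono_normal[OF assms(1)] by blast
  note w' = kernelD[OF w]
  obtain u where u: "u \<in> Ar C" "Dom C u = Dom C h" "Cod C u = Dom C k" "k \<cdot> u = h"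
    using assms(2) by (rule subobject_leE)
  have cod: "Cod C h = Dom C w" using u w' comp_closed(3)[of u k] by simp
  have "is_zero_arrow C ((w \<cdot> k) \<cdot> u)" using u w' by (simp add: comp_zero_left del: comp_assoc)
  then have "is_zero_arrow C (w \<cdot> h)" using u w' by simp
  then show ?thesis using cod w' assms(3,4) im by (intro kernel_universal[OF w]) auto
qed

text \<open>The definition of an intersection tests against monomorphisms only. An arbitrary arrow
  \<open>h\<close> is replaced by its image, which lies below every \<open>k\<close> in the family
  by \<open>image_le\<close>.\<close>

lemma intersection_universal:
  assumes z: "is_intersection C M \<S> z" and h: "h \<in> Ar C" "Cod C h = M"
    and k: "\<And>k. k \<in> \<S> \<Longrightarrow> is_mono C k \<and> subobject_le C h k"
  shows "subobject_le C h z"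
proof -
  obtain m b where m: "is_mono C m" "Cod C m = Cod C h" "b \<in> Ar C" "Dom C b = Dom C h" "Cod C b = Dom C m"
    "m \<cdot> b = h" and im: "\<forall>w\<in>Ar C. Dom C w = Cod C h \<and> is_zero_arrow C (w \<cdot> h) \<longrightarrow> is_zero_arrow C (w \<cdot> m)"
    using image_factorization[OF h(1)] by blast
  have "subobject_le C m k" if "k \<in> \<S>" for k
    using k[OF that] m h by (intro image_le[where h = h, OF _ _ _ _ _ im]) auto
  then have "Ball \<S> (subobject_le C m)" by blast
  moreover have "is_mono C m" "Cod C m = M" using m h by auto
  ultimately have "subobject_le C m z"
    using z unfolding is_intersection_def is_subobject_def by blast
  moreover have "subobject_le C h m" using m subobject_leI[of b m] by auto
  ultimately show ?thesis
    using subobject_le_trans[of h m z] z unfolding is_intersection_def is_subobject_def by auto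
qed

text \<open>Write \<open>b\<close> as the kernel of some \<open>w\<close>. The intersection is the
  part of \<open>a\<close> killed by \<open>w\<close>, namely \<open>a\<close> composed with the
  kernel of \<open>w \<cdot> a\<close>. The universal property is given for all arrows, not only for
  monomorphisms.\<close>

lemma ex_binary_intersection:
  assumes a: "is_mono C a" and b: "is_mono C b" and ab: "Cod C a = Cod C b"
  obtains z where "is_mono C z" "Cod C z = Cod C a" "subobject_le C z a" "subobject_le C z b"
    "\<And>h. \<lbrakk>h \<in> Ar C; Cod C h = Cod C a; subobject_le C h a; subobject_le C h b\<rbrakk> \<Longrightarrow> subobject_le C h z"
proof -
  obtain w where w: "is_kernel C b w" using mono_normal[OF b] by blast
  note w' = kernelD[OF w]
  have wa: "w \<cdot> a \<in> Ar C" "Dom C (w \<cdot> a) = Dom C a" using w' a ab by auto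
  obtain k where k: "is_kernel C k (w \<cdot> a)" using kernels[OF wa(1)] by blast
  note k' = kernelD[OF k]
  have ak: "a \<cdot> k \<in> Ar C" "Cod C (a \<cdot> k) = Cod C a" "Dom C (a \<cdot> k) = Dom C k"
    using k' wa a by auto
  show thesis
  proof (rule that[of "a \<cdot> k"])
    show "is_mono C (a \<cdot> k)" using mono_comp[OF kernel_mono[OF k] a] k' wa by auto
    show "subobject_le C (a \<cdot> k) a" using k' wa a by (intro subobject_leI) auto
    show "subobject_le C (a \<cdot> k) b"
      by (rule kernel_universal[OF w]) (use k' wa w' a ab in auto)
    fix h assume h: "h \<in> Ar C" "Cod C h = Cod C a" "subobject_le C h a" "subobject_le C h b"
    obtain u where u: "u \<in> Ar C" "Dom C u = Dom C h" "Cod C u = Dom C a" "a \<cdot> u = h"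
      using h(3) by (rule subobject_leE)
    obtain v where v: "v \<in> Ar C" "Dom C v = Dom C h" "Cod C v = Dom C b" "b \<cdot> v = h"
      using h(4) by (rule subobject_leE)
    have "is_zero_arrow C ((w \<cdot> b) \<cdot> v)" using v w' by (simp add: comp_zero_left del: comp_assoc)
    then have "is_zero_arrow C (w \<cdot> h)" using v w' b by simp
    then have "is_zero_arrow C ((w \<cdot> a) \<cdot> u)" using u w' a ab by simp
    then have "subobject_le C u k" using u wa by (intro kernel_universal[OF k]) auto
    then obtain t where t: "t \<in> Ar C" "Dom C t = Dom C u" "Cod C t = Dom C k" "k \<cdot> t = u"
      by (rule subobject_leE)
    have "(a \<cdot> k) \<cdot> t = h" using t u k' wa a by simp
    then show "subobject_le C h (a \<cdot> k)" using subobject_leI[of t "a \<cdot> k"] t ak by auto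
  qed (rule ak)
qed

text \<open>The image of \<open>e\<close> is the kernel \<open>s\<close> of the complement
  \<open>e' = 1 - e\<close>: since \<open>e'\<close> kills \<open>e\<close>, \<open>e\<close>
  factors through \<open>s\<close> as \<open>s \<cdot> t\<close>. Conversely \<open>e\<close> fixes
  \<open>s\<close>, and cancelling the monomorphism \<open>s\<close> gives the retraction
  identity.\<close>

lemma split_idempotent:
  assumes e: "e \<in> Ar C" "Dom C e = M" "Cod C e = M" "e \<cdot> e = e"
  obtains s t where "s \<in> Ar C" "t \<in> Ar C" "Cod C s = M" "Dom C t = M" "Cod C t = Dom C s"
    "s \<cdot> t = e" "t \<cdot> s = Idt C (Dom C s)"
proof -
  have M: "M \<in> Ob C" using e by auto
  obtain e' where e': "e' \<in> Ar C" "Dom C e' = M" "Cod C e' = M" "Plus C e e' = Idt C M"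
    using ex_difference[of e "Idt C M"] e M by auto
  have "e = (Plus C e e') \<cdot> e" unfolding e'(4) using e by simp
  also have "\<dots> = Plus C e (e' \<cdot> e)" using e e'(1-3) by simp
  finally have "Plus C e (e' \<cdot> e) = e" ..
  then have z: "is_zero_arrow C (e' \<cdot> e)"
    by (rule plus_eq_self_imp_zero) (use e e'(1-3) in auto)
  obtain s where s: "is_kernel C s e'" using kernels[OF e'(1)] by blast
  note s' = kernelD[OF s]
  have "subobject_le C e s"
    by (rule kernel_universal[OF s e(1) _ z]) (use e e' in simp)
  then obtain t where t: "t \<in> Ar C" "Dom C t = Dom C e" "Cod C t = Dom C s" "s \<cdot> t = e"
    by (rule subobject_leE)
  have "s = Plus C e e' \<cdot> s" unfolding e'(4) using s' e' by simp
  also have "\<dots> = Plus C (e \<cdot> s) (e' \<cdot> s)" using e e'(1-3) s' by simp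
  also have "\<dots> = e \<cdot> s" using s' e e'(1-3) by simp
  finally have "e \<cdot> s = s" ..
  then have st: "s \<cdot> (t \<cdot> s) = s" using comp_cong_left[of s t e s] t s' e e' by simp
  have "t \<cdot> s = Idt C (Dom C s)"
    by (rule mono_cancel[OF kernel_mono[OF s]]) (use st s' t e e' in auto)
  then show thesis using that[of s t] s' t e e' by auto
qed

end

section \<open>Idempotents and common kernels\<close>

text \<open>The generalized elements of the common kernel of \<open>G\<close>. Collecting all arrows
  into \<open>M\<close> that \<open>G\<close> kills makes the common kernel available before a
  subobject representing it is known to exist, and independent of the choice of
  representative.\<close>

definition annihilated :: "('o, 'a) additive_category_data \<Rightarrow> 'o \<Rightarrow> 'a set \<Rightarrow> 'a set" where
  "annihilated C M G = {x \<in> Ar C. Cod C x = M \<and> (\<forall>g\<in>G. is_zero_arrow C (g \<cdot>\<^bsub>C\<^esub> x))}"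

text \<open>
  \<open>K\<close> has a largest subobject of \<open>M\<close>, which is essential in the image of the idempotent \<open>e\<close>.
\<close>

definition summand_hull :: "('o, 'a) additive_category_data \<Rightarrow> 'o \<Rightarrow> 'a set \<Rightarrow> 'a \<Rightarrow> bool" where
  "summand_hull C M K e \<longleftrightarrow> e \<in> arrows C M M \<and> e \<cdot>\<^bsub>C\<^esub> e = e \<and> (\<forall>x\<in>K. e \<cdot>\<^bsub>C\<^esub> x = x) \<and>
     (\<exists>m\<in>K. is_mono C m \<and> (\<forall>x\<in>K. subobject_le C x m)) \<and>
     (\<forall>x. is_mono C x \<and> Cod C x = M \<and> e \<cdot>\<^bsub>C\<^esub> x = x \<and>
          (\<forall>y\<in>Ar C. Cod C y = Dom C x \<and> x \<cdot>\<^bsub>C\<^esub> y \<in> K \<longrightarrow> is_zero_arrow C (x \<cdot>\<^bsub>C\<^esub> y))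
          \<longrightarrow> is_zero_arrow C x)"

text \<open>The equation amounts to \<open>(1 - e) h e = 0\<close>, so it says that the image of
  \<open>e\<close> is fully invariant. Read in the opposite category it becomes
  \<open>e h (1 - e) = 0\<close>, which is full invariance of the kernel of
  \<open>e\<close>.\<close>

definition invariant_idempotent :: "('o, 'a) additive_category_data \<Rightarrow> 'o \<Rightarrow> 'a \<Rightarrow> bool" where
  "invariant_idempotent C M e \<longleftrightarrow> (\<forall>h\<in>arrows C M M. e \<cdot>\<^bsub>C\<^esub> (h \<cdot>\<^bsub>C\<^esub> e) = h \<cdot>\<^bsub>C\<^esub> e)"

lemma summand_hullD:
  assumes "summand_hull C M K e"
  shows "e \<in> arrows C M M" "e \<cdot>\<^bsub>C\<^esub> e = e" "x \<in> K \<Longrightarrow> e \<cdot>\<^bsub>C\<^esub> x = x"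
    "\<exists>m\<in>K. is_mono C m \<and> (\<forall>x\<in>K. subobject_le C x m)"
    "\<lbrakk>is_mono C x; Cod C x = M; e \<cdot>\<^bsub>C\<^esub> x = x;
      \<And>y. \<lbrakk>y \<in> Ar C; Cod C y = Dom C x; x \<cdot>\<^bsub>C\<^esub> y \<in> K\<rbrakk> \<Longrightarrow> is_zero_arrow C (x \<cdot>\<^bsub>C\<^esub> y)\<rbrakk>
     \<Longrightarrow> is_zero_arrow C x"
  using assms unfolding summand_hull_def by blast+

context abelian_category
begin

lemma annihilated_comp:
  assumes "x \<in> annihilated C M G" "y \<in> Ar C" "Cod C y = Dom C x"
    and "\<And>g. g \<in> G \<Longrightarrow> g \<in> Ar C \<and> Dom C g = M"
  shows "x \<cdot> y \<in> annihilated C M G"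
  unfolding annihilated_def
proof (intro CollectI conjI ballI)
  fix g assume "g \<in> G"
  then show "is_zero_arrow C (g \<cdot> (x \<cdot> y))"
    using assms(1-3) assms(4)[OF \<open>g \<in> G\<close>] by (intro comp_zero_left_assoc) (auto simp: annihilated_def)
qed (use assms in \<open>auto simp: annihilated_def\<close>)

text \<open>This is the step of the induction over the summands. Invariance is a separate conclusion
  so that the plain and the strong version can share the construction.\<close>

lemma summand_hull_inter:
  assumes G1: "\<And>g. g \<in> G1 \<Longrightarrow> g \<in> Ar C \<and> Dom C g = M"
    and G2: "\<And>g. g \<in> G2 \<Longrightarrow> g \<in> Ar C \<and> Dom C g = M"
    and h2: "summand_hull C M (annihilated C M G2) e2"
    and h1: "summand_hull C M (annihilated C M ((\<lambda>g. g \<cdot> e2) ` G1)) e"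
  shows "summand_hull C M (annihilated C M (G1 \<union> G2)) (e2 \<cdot> e)"
    and "invariant_idempotent C M e2 \<Longrightarrow> invariant_idempotent C M e \<Longrightarrow> invariant_idempotent C M (e2 \<cdot> e)"
proof -
  have e2: "e2 \<in> Ar C" "Dom C e2 = M" "Cod C e2 = M" "e2 \<cdot> e2 = e2"
    using summand_hullD(1,2)[OF h2] by auto
  have e: "e \<in> Ar C" "Dom C e = M" "Cod C e = M" "e \<cdot> e = e"
    using summand_hullD(1,2)[OF h1] by auto
  note fix2 = summand_hullD(3)[OF h2] and fix1 = summand_hullD(3)[OF h1]
    and ess2 = summand_hullD(5)[OF h2] and ess1 = summand_hullD(5)[OF h1]
  have M: "M \<in> Ob C" using e by auto
  \<comment> \<open>\<open>k\<close> is the complement \<open>1 - e2\<close>.\<close>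
  obtain k where k: "k \<in> Ar C" "Dom C k = M" "Cod C k = M" "Plus C e2 k = Idt C M"
    using ex_difference[of e2 "Idt C M"] e2 M by auto
  have "e2 = e2 \<cdot> Plus C e2 k" unfolding k(4) using e2 by simp
  also have "\<dots> = Plus C e2 (e2 \<cdot> k)" using e2 k(1-3) by simp
  finally have "Plus C e2 (e2 \<cdot> k) = e2" ..
  then have e2k: "is_zero_arrow C (e2 \<cdot> k)"
    by (rule plus_eq_self_imp_zero) (use e2 k(1-3) in auto)
  \<comment> \<open>Twisting the family by \<open>e2\<close> places the whole complement
    \<open>k\<close> in its common kernel, which forces \<open>e\<close> to fix
    \<open>k\<close>.\<close>
  have "k \<in> annihilated C M ((\<lambda>g. g \<cdot> e2) ` G1)"
    unfolding annihilated_def using k(1-3) e2 G1 e2k by auto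
  from fix1[OF this] have ek: "e \<cdot> k = k" .
  have "e = e \<cdot> Plus C e2 k" unfolding k(4) using e by simp
  also have "\<dots> = Plus C (e \<cdot> e2) k" using e e2 k(1-3) ek by simp
  finally have e_sum: "Plus C (e \<cdot> e2) k = e" ..
  \<comment> \<open>Here \<open>e = e \<cdot> e\<close> is expanded through
    \<open>e = e e2 + k\<close>, and \<open>e\<close> itself through \<open>1 = e2 + k\<close>. Both
    expansions contain the term \<open>k \<cdot> e\<close>; cancelling it shows that
    \<open>e\<close> fixes \<open>e2 \<cdot> e\<close>.\<close>
  have "Plus C (e \<cdot> (e2 \<cdot> e)) (k \<cdot> e) = Plus C (e \<cdot> e2) k \<cdot> e"
    using e e2 k(1-3) by simp
  also have "\<dots> = e" unfolding e_sum using e by simp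
  also have "\<dots> = Plus C e2 k \<cdot> e" unfolding k(4) using e by simp
  also have "\<dots> = Plus C (e2 \<cdot> e) (k \<cdot> e)" using e e2 k(1-3) by simp
  finally have ee2e: "e \<cdot> (e2 \<cdot> e) = e2 \<cdot> e"
    by (rule plus_right_cancel) (use e e2 k(1-3) in auto)
  define p where "p = e2 \<cdot> e"
  have p: "p \<in> Ar C" "Dom C p = M" "Cod C p = M" using e e2 unfolding p_def by auto
  have ep: "e \<cdot> p = p" using ee2e unfolding p_def .
  have e2p: "e2 \<cdot> p = p" unfolding p_def using comp_cong_left[of e2 e2 e2 e] e e2 by simp
  have pp: "p \<cdot> p = p" using comp_cong_left[of e2 e p p] p e e2 ep e2p p_def by simp
  have fixp: "e2 \<cdot> x = x" "e \<cdot> x = x" if "x \<in> Ar C" "Cod C x = M" "p \<cdot> x = x" for x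
    using that comp_cong_left[OF e2p that(1)] comp_cong_left[OF ep that(1)] p e e2 by auto
  have ann2: "x \<in> annihilated C M G2" if "x \<in> annihilated C M (G1 \<union> G2)" for x
    using that unfolding annihilated_def by auto
  \<comment> \<open>On arrows fixed by \<open>e2\<close>, the twisted family and \<open>G1\<close>
    have the same annihilator; \<open>ann1\<close> and \<open>ann1'\<close> are the two
    inclusions.\<close>
  have ann1: "x \<in> annihilated C M ((\<lambda>g. g \<cdot> e2) ` G1)"
    if "x \<in> annihilated C M G1" "e2 \<cdot> x = x" for x
    using that G1 e2 unfolding annihilated_def by auto
  have ann1': "x \<in> annihilated C M G1"
    if "x \<in> annihilated C M ((\<lambda>g. g \<cdot> e2) ` G1)" "e2 \<cdot> x = x" for x
    using that G1 e2 unfolding annihilated_def by auto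
  have ann12: "x \<in> annihilated C M G1" if "x \<in> annihilated C M (G1 \<union> G2)" for x
    using that unfolding annihilated_def by auto
  show "summand_hull C M (annihilated C M (G1 \<union> G2)) (e2 \<cdot> e)"
    unfolding summand_hull_def p_def[symmetric]
  proof (intro conjI ballI allI impI)
    fix x assume x: "x \<in> annihilated C M (G1 \<union> G2)"
    have "e2 \<cdot> x = x" using fix2 ann2[OF x] by simp
    moreover from this have "e \<cdot> x = x" using fix1 ann1 ann12[OF x] by simp
    ultimately show "p \<cdot> x = x" unfolding p_def using x e e2 unfolding annihilated_def by auto
  next
    obtain m2 where m2: "m2 \<in> annihilated C M G2" "is_mono C m2"
      "\<And>x. x \<in> annihilated C M G2 \<Longrightarrow> subobject_le C x m2"
      using summand_hullD(4)[OF h2] by auto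
    obtain m1 where m1: "m1 \<in> annihilated C M ((\<lambda>g. g \<cdot> e2) ` G1)" "is_mono C m1"
      "\<And>x. x \<in> annihilated C M ((\<lambda>g. g \<cdot> e2) ` G1) \<Longrightarrow> subobject_le C x m1"
      using summand_hullD(4)[OF h1] by auto
    have cod: "Cod C m1 = M" "Cod C m2 = M" using m1 m2 unfolding annihilated_def by auto
    \<comment> \<open>The largest subobject for the union is the intersection of those for the two
      families. It lies in \<open>m2\<close>, so \<open>e2\<close> fixes it, and the twist in the
      first family then disappears.\<close>
    obtain z where z: "is_mono C z" "Cod C z = Cod C m1" "subobject_le C z m1" "subobject_le C z m2"
      "\<And>h. \<lbrakk>h \<in> Ar C; Cod C h = Cod C m1; subobject_le C h m1; subobject_le C h m2\<rbrakk> \<Longrightarrow> subobject_le C h z"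
      using ex_binary_intersection[OF m1(2) m2(2)] cod by metis
    obtain u where u: "u \<in> Ar C" "Dom C u = Dom C z" "Cod C u = Dom C m1" "m1 \<cdot> u = z"
      using z(3) by (rule subobject_leE)
    obtain v where v: "v \<in> Ar C" "Dom C v = Dom C z" "Cod C v = Dom C m2" "m2 \<cdot> v = z"
      using z(4) by (rule subobject_leE)
    have z2: "z \<in> annihilated C M G2" using annihilated_comp[OF m2(1) v(1,3) G2] v by auto
    then have e2z: "e2 \<cdot> z = z" using fix2 by auto
    have z1: "z \<in> annihilated C M G1"
      unfolding annihilated_def
    proof (intro CollectI conjI ballI)
      fix g assume g: "g \<in> G1"
      then have "is_zero_arrow C ((g \<cdot> e2) \<cdot> m1)" using m1 unfolding annihilated_def by auto
      then have "is_zero_arrow C (((g \<cdot> e2) \<cdot> m1) \<cdot> u)"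
        by (rule comp_zero_left) (use u G1[OF g] e2 m1(2) cod in auto)
      then show "is_zero_arrow C (g \<cdot> z)" using G1[OF g] e2 u m1(2) cod e2z by simp
    qed (use z cod in auto)
    show "\<exists>m\<in>annihilated C M (G1 \<union> G2). is_mono C m \<and> (\<forall>x\<in>annihilated C M (G1 \<union> G2). subobject_le C x m)"
    proof (intro bexI[of _ z] conjI ballI z(1))
      show "z \<in> annihilated C M (G1 \<union> G2)" using z1 z2 unfolding annihilated_def by auto
      fix x assume x: "x \<in> annihilated C M (G1 \<union> G2)"
      have x2: "e2 \<cdot> x = x" using fix2 ann2[OF x] by simp
      show "subobject_le C x z"
        using x m2(3)[OF ann2[OF x]] m1(3)[OF ann1[OF ann12[OF x] x2]] cod
        by (intro z(5)) (auto simp: annihilated_def)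
    qed
  next
    fix x assume "is_mono C x \<and> Cod C x = M \<and> p \<cdot> x = x \<and>
      (\<forall>y\<in>Ar C. Cod C y = Dom C x \<and> x \<cdot> y \<in> annihilated C M (G1 \<union> G2) \<longrightarrow> is_zero_arrow C (x \<cdot> y))"
    then have x: "is_mono C x" "Cod C x = M" "p \<cdot> x = x"
      and essx: "\<And>y. \<lbrakk>y \<in> Ar C; Cod C y = Dom C x; x \<cdot> y \<in> annihilated C M (G1 \<union> G2)\<rbrakk> \<Longrightarrow> is_zero_arrow C (x \<cdot> y)"
      by auto
    note fx = fixp[OF mono_ar[OF x(1)] x(2,3)]
    show "is_zero_arrow C x"
    proof (rule ess1[OF x(1,2) fx(2)])
      fix y assume y: "y \<in> Ar C" "Cod C y = Dom C x" and xy: "x \<cdot> y \<in> annihilated C M ((\<lambda>g. g \<cdot> e2) ` G1)"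
      have "e2 \<cdot> (x \<cdot> y) = x \<cdot> y"
        using comp_cong_left[OF fx(1)] y x e2 by simp
      then have xy1: "x \<cdot> y \<in> annihilated C M G1" using ann1' xy by simp
      have xyA: "x \<cdot> y \<in> Ar C" using x y by simp
      \<comment> \<open>Essentiality for \<open>e2\<close> is stated for monomorphisms, so
        \<open>x \<cdot> y\<close> is replaced by its image \<open>m\<close>. This lies inside
        \<open>x\<close> and is still killed by \<open>G1\<close>, so whatever \<open>G2\<close>
        kills in \<open>m\<close> is killed by both families and vanishes by the assumption on
        \<open>x\<close>.\<close>
      obtain m b where m: "is_mono C m" "Cod C m = Cod C (x \<cdot> y)" "b \<in> Ar C" "Dom C b = Dom C (x \<cdot> y)"
        "Cod C b = Dom C m" "m \<cdot> b = x \<cdot> y"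
        and im: "\<forall>w\<in>Ar C. Dom C w = Cod C (x \<cdot> y) \<and> is_zero_arrow C (w \<cdot> (x \<cdot> y)) \<longrightarrow> is_zero_arrow C (w \<cdot> m)"
        using image_factorization[OF xyA] by blast
      have "subobject_le C m x"
        by (rule image_le[where h = "x \<cdot> y", OF x(1) _ _ m(2) _ im]) (use x y m in \<open>auto intro: subobject_leI\<close>)
      then obtain c where c: "c \<in> Ar C" "Dom C c = Dom C m" "Cod C c = Dom C x" "x \<cdot> c = m"
        by (rule subobject_leE)
      have m1: "m \<in> annihilated C M G1"
        using xy1 G1 im m x y unfolding annihilated_def by auto
      have "is_zero_arrow C m"
      proof (rule ess2[OF m(1)])
        show "Cod C m = M" using m x y by simp
        show "e2 \<cdot> m = m" using comp_cong_left[OF fx(1) c(1)] c x e2 by simp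
        fix y' assume y': "y' \<in> Ar C" "Cod C y' = Dom C m" "m \<cdot> y' \<in> annihilated C M G2"
        have eq: "x \<cdot> (c \<cdot> y') = m \<cdot> y'" using comp_cong_left[OF c(4)] y' c x by simp
        have "m \<cdot> y' \<in> annihilated C M G1" using annihilated_comp[OF m1 y'(1,2) G1] by simp
        then have "x \<cdot> (c \<cdot> y') \<in> annihilated C M (G1 \<union> G2)"
          unfolding eq using y'(3) unfolding annihilated_def by auto
        then show "is_zero_arrow C (m \<cdot> y')" using essx[of "c \<cdot> y'"] eq c y' by auto
      qed
      then have "is_zero_arrow C (m \<cdot> b)" by (rule comp_zero_left) (use m(3,5) in auto)
      then show "is_zero_arrow C (x \<cdot> y)" using m by simp
    qed
  qed (use p pp in auto)
  show "invariant_idempotent C M (e2 \<cdot> e)" if "invariant_idempotent C M e2" "invariant_idempotent C M e"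
    unfolding invariant_idempotent_def p_def[symmetric]
  proof
    fix h assume h: "h \<in> arrows C M M"
    have i2: "e2 \<cdot> (h \<cdot> e2) = h \<cdot> e2" and i1: "e \<cdot> (h \<cdot> e) = h \<cdot> e"
      using that h unfolding invariant_idempotent_def by auto
    \<comment> \<open>Since \<open>p\<close> factors through \<open>e2\<close> by definition and
      also through \<open>e\<close> because \<open>e \<cdot> p = p\<close>, both idempotents fix
      \<open>h \<cdot> p\<close>, and so does their composite.\<close>
    have "e2 \<cdot> (h \<cdot> p) = (e2 \<cdot> (h \<cdot> e2)) \<cdot> e" using h e e2 by (simp add: p_def)
    also have "\<dots> = h \<cdot> p" unfolding i2 using h e e2 by (simp add: p_def)
    finally have A: "e2 \<cdot> (h \<cdot> p) = h \<cdot> p" .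
    have "e \<cdot> (h \<cdot> p) = (e \<cdot> (h \<cdot> e)) \<cdot> p" using h e e2 p ep by simp
    also have "\<dots> = h \<cdot> p" unfolding i1 using h e e2 p ep by simp
    finally have B: "e \<cdot> (h \<cdot> p) = h \<cdot> p" .
    have "p \<cdot> (h \<cdot> p) = e2 \<cdot> (e \<cdot> (h \<cdot> p))" using h e e2 p by (simp add: p_def)
    then show "p \<cdot> (h \<cdot> p) = h \<cdot> p" unfolding A B .
  qed
qed

end

section \<open>The opposite category\<close>

definition opp :: "('o, 'a) additive_category_data \<Rightarrow> ('o, 'a) additive_category_data" where
  "opp C = \<lparr>Ob = Ob C, Ar = Ar C, Dom = Cod C, Cod = Dom C, Idt = Idt C,
     Comp = (\<lambda>g f. f \<cdot>\<^bsub>C\<^esub> g), Plus = Plus C, Zero = (\<lambda>A B. Zero C B A)\<rparr>"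

lemma opp_sel [simp]:
  "Ob (opp C) = Ob C" "Ar (opp C) = Ar C" "Dom (opp C) = Cod C" "Cod (opp C) = Dom C"
  "Idt (opp C) = Idt C" "g \<cdot>\<^bsub>opp C\<^esub> f = f \<cdot>\<^bsub>C\<^esub> g" "Plus (opp C) = Plus C" "Zero (opp C) A B = Zero C B A"
  by (simp_all add: opp_def)

lemma opp_arrows [simp]: "arrows (opp C) A B = arrows C B A"
  by (auto simp: arrows_def)

lemma opp_arrow_group [simp]: "arrow_group (opp C) A A = arrow_group C A A"
  by (simp add: arrow_group_def)

lemma opp_is_mono [simp]: "is_mono (opp C) m \<longleftrightarrow> is_epi C m"
  by (simp add: is_mono_def is_epi_def)

lemma opp_is_epi [simp]: "is_epi (opp C) m \<longleftrightarrow> is_mono C m"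
  by (simp add: is_mono_def is_epi_def)

lemma opp_is_zero_arrow [simp]: "is_zero_arrow (opp C) f \<longleftrightarrow> is_zero_arrow C f"
  by (simp add: is_zero_arrow_def)

lemma opp_is_kernel [simp]: "is_kernel (opp C) k f \<longleftrightarrow> is_cokernel C k f"
  by (simp add: is_kernel_def is_cokernel_def)

lemma opp_is_cokernel [simp]: "is_cokernel (opp C) k f \<longleftrightarrow> is_kernel C k f"
  by (simp add: is_kernel_def is_cokernel_def)

lemma opp_is_direct_sum:
  "is_direct_sum C I X S \<iota> \<pi> \<Longrightarrow> is_direct_sum (opp C) I X S \<pi> \<iota>"
  unfolding is_direct_sum_def by auto

section \<open>Duality, two-term decompositions and fully invariant summands\<close>

context abelian_category
begin

lemma abelian_category_opp: "abelian_category (opp C)"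
proof (intro abelian_category.intro preadditive_category.intro category.intro
    preadditive_category_axioms.intro abelian_category_axioms.intro)
  fix A B assume "A \<in> Ob (opp C)" "B \<in> Ob (opp C)"
  then have "comm_group (arrow_group C B A)" by (intro arrow_group) auto
  moreover have "arrow_group (opp C) A B = arrow_group C B A"
    by (simp add: arrow_group_def)
  ultimately show "comm_group (arrow_group (opp C) A B)" by simp
next
  fix n :: nat and X assume "\<forall>i\<in>{1..n}. X i \<in> Ob (opp C)"
  then obtain S \<iota> \<pi> where "is_direct_sum C {1..n} X S \<iota> \<pi>"
    using finite_direct_sums[of n X] by auto
  then show "\<exists>S \<iota> \<pi>. is_direct_sum (opp C) {1..n} X S \<iota> \<pi>"
    by (intro exI) (rule opp_is_direct_sum)
qed (auto simp: kernels cokernels mono_normal epi_normal)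

text \<open>The epimorphism \<open>x\<close> is the cokernel of some \<open>f\<close>, and
  \<open>f\<close> factors through the kernel \<open>w\<close> of \<open>x\<close>. Hence an arrow
  killing \<open>w\<close> also kills \<open>f\<close> and factors through \<open>x\<close>.\<close>

lemma epi_eq_cokernel_of_kernel:
  assumes x: "is_epi C x" and w: "is_kernel C w x"
    and v: "v \<in> Ar C" "Dom C v = Dom C x" "is_zero_arrow C (v \<cdot> w)"
  obtains y where "y \<in> Ar C" "Dom C y = Cod C x" "Cod C y = Cod C v" "y \<cdot> x = v"
proof -
  obtain f where f: "is_cokernel C x f" using epi_normal[OF x] by blast
  note f' = cokernelD[OF f]
  note w' = kernelD[OF w]
  have "subobject_le C f w" by (rule kernel_universal[OF w]) (use f' in auto)
  then obtain a where a: "a \<in> Ar C" "Dom C a = Dom C f" "Cod C a = Dom C w" "w \<cdot> a = f"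
    by (rule subobject_leE)
  have "is_zero_arrow C (v \<cdot> (w \<cdot> a))"
    by (rule comp_zero_left_assoc) (use v w' a in auto)
  then have "is_zero_arrow C (v \<cdot> f)" using a by simp
  then show thesis using that cokernel_universal[OF f v(1)] v f' by metis
qed

text \<open>Dually, \<open>x\<close> is the kernel of some \<open>f\<close>, and \<open>f\<close>
  factors through the cokernel \<open>w\<close>; so \<open>f\<close> kills everything that
  \<open>w\<close> kills.\<close>

lemma mono_eq_kernel_of_cokernel:
  assumes x: "is_mono C x" and w: "is_cokernel C w x"
    and v: "v \<in> Ar C" "Cod C v = Cod C x" "is_zero_arrow C (w \<cdot> v)"
  shows "subobject_le C v x"
proof -
  obtain f where f: "is_kernel C x f" using mono_normal[OF x] by blast
  note f' = kernelD[OF f]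
  note w' = cokernelD[OF w]
  obtain a where a: "a \<in> Ar C" "Dom C a = Cod C w" "Cod C a = Cod C f" "a \<cdot> w = f"
    using cokernel_universal[OF w f'(1)] f' by metis
  have "is_zero_arrow C (a \<cdot> (w \<cdot> v))"
    by (rule comp_zero_right) (use v w' a in auto)
  then have "is_zero_arrow C (f \<cdot> v)" using comp_cong_left[of a w f v] a w' v by simp
  then show ?thesis by (intro kernel_universal[OF f]) (use v f' in auto)
qed

text \<open>A biproduct with the two inclusions \<open>s\<close>, \<open>s'\<close> and projections
  \<open>t\<close>, \<open>t'\<close>, free of indices and of \<open>finprod\<close>. The vanishing
  of the mixed composites is derived in \<open>splitting_zero\<close>.\<close>

definition splitting :: "'a \<Rightarrow> 'b \<Rightarrow> 'b \<Rightarrow> 'b \<Rightarrow> 'b \<Rightarrow> bool" where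
  "splitting M s t s' t' \<longleftrightarrow> s \<in> Ar C \<and> t \<in> Ar C \<and> s' \<in> Ar C \<and> t' \<in> Ar C \<and>
     Cod C s = M \<and> Dom C t = M \<and> Cod C s' = M \<and> Dom C t' = M \<and> Cod C t = Dom C s \<and> Cod C t' = Dom C s' \<and>
     t \<cdot> s = Idt C (Dom C s) \<and> t' \<cdot> s' = Idt C (Dom C s') \<and> Plus C (s \<cdot> t) (s' \<cdot> t') = Idt C M"

lemma splittingD:
  assumes "splitting M s t s' t'"
  shows "s \<in> Ar C" "t \<in> Ar C" "s' \<in> Ar C" "t' \<in> Ar C" "Cod C s = M" "Dom C t = M" "Cod C s' = M"
    "Dom C t' = M" "Cod C t = Dom C s" "Cod C t' = Dom C s'" "t \<cdot> s = Idt C (Dom C s)"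
    "t' \<cdot> s' = Idt C (Dom C s')" "Plus C (s \<cdot> t) (s' \<cdot> t') = Idt C M"
  using assms unfolding splitting_def by auto

lemma splitting_sym: "splitting M s t s' t' \<Longrightarrow> splitting M s' t' s t"
  unfolding splitting_def using plus_commute[of "s \<cdot> t" "s' \<cdot> t'"] by auto

lemma splitting_mono: "splitting M s t s' t' \<Longrightarrow> is_mono C s"
  using splittingD[of M s t s' t'] by (intro split_mono[of t]) auto

lemma splitting_retract:
  assumes "splitting M s t s' t'" "x \<in> Ar C" "Cod C x = Dom C s"
  shows "t \<cdot> (s \<cdot> x) = x"
  using comp_cong_left[of t s "Idt C (Dom C s)" x] splittingD[OF assms(1)] assms(2,3) by simp

text \<open>Composing \<open>1 = s t + s' t'\<close> with \<open>s\<close> gives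
  \<open>s = s + s' t' s\<close>, so \<open>s' t' s\<close> vanishes; the monomorphism
  \<open>s'\<close> is then cancelled.\<close>

lemma splitting_zero:
  assumes "splitting M s t s' t'"
  shows "is_zero_arrow C (t' \<cdot> s)"
proof -
  note d = splittingD[OF assms]
  have "Plus C s (s' \<cdot> (t' \<cdot> s)) = Plus C (s \<cdot> t) (s' \<cdot> t') \<cdot> s"
    using d(1-12) by simp
  also have "\<dots> = s" unfolding d(13) using d(1-12) by simp
  finally have "is_zero_arrow C (s' \<cdot> (t' \<cdot> s))"
    by (rule plus_eq_self_imp_zero) (use d(1-12) in auto)
  then show ?thesis
    by (rule mono_zero[OF splitting_mono[OF splitting_sym[OF assms]]]) (use d(1-12) in auto)
qed

lemma splitting_decomp:
  assumes "splitting M s t s' t'" "x \<in> Ar C" "Cod C x = M"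
  shows "Plus C (s \<cdot> (t \<cdot> x)) (s' \<cdot> (t' \<cdot> x)) = x"
proof -
  note d = splittingD[OF assms(1)]
  have "Plus C (s \<cdot> (t \<cdot> x)) (s' \<cdot> (t' \<cdot> x)) = Plus C (s \<cdot> t) (s' \<cdot> t') \<cdot> x"
    using d(1-12) assms by simp
  then show ?thesis unfolding d(13) using assms by simp
qed

lemma splitting_decomp_right:
  assumes "splitting M s t s' t'" "x \<in> Ar C" "Dom C x = M"
  shows "Plus C (x \<cdot> (s \<cdot> t)) (x \<cdot> (s' \<cdot> t')) = x"
proof -
  note d = splittingD[OF assms(1)]
  have "Plus C (x \<cdot> (s \<cdot> t)) (x \<cdot> (s' \<cdot> t')) = x \<cdot> Plus C (s \<cdot> t) (s' \<cdot> t')"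
    using d(1-12) assms by simp
  then show ?thesis unfolding d(13) using assms by simp
qed

lemma direct_sum_pair:
  assumes "a \<in> Ar C" "b \<in> Ar C" "Dom C a = M" "Cod C a = M" "Dom C b = M" "Cod C b = M"
    "f 1 = a" "f 2 = b"
  shows "finprod (arrow_group C M M) f {1..2::nat} = Plus C a b"
proof -
  have M: "M \<in> Ob C" using assms by auto
  interpret G: comm_group "arrow_group C M M" by (rule arrow_group[OF M M])
  have ab: "f 1 \<in> carrier (arrow_group C M M)" "f 2 \<in> carrier (arrow_group C M M)"
    using assms by (auto simp: arrow_group_def)
  have "finprod (arrow_group C M M) f {1..2::nat} = finprod (arrow_group C M M) f (insert 1 {2})"
    by (rule arg_cong[of "{1..2}"]) auto
  also have "\<dots> = f 1 \<otimes>\<^bsub>arrow_group C M M\<^esub> f 2"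
    using ab by (simp add: Pi_iff)
  finally show ?thesis using assms by (simp add: arrow_group_def)
qed

lemma direct_summand_iff_splitting:
  "is_direct_summand C M d \<longleftrightarrow> (\<exists>t s' t'. splitting M d t s' t')"
proof
  assume "is_direct_summand C M d"
  then obtain X \<iota> \<pi> where s: "is_direct_sum C {1..2::nat} X M \<iota> \<pi>" and d: "\<iota> 1 = d"
    unfolding is_direct_summand_def by auto
  have ty: "\<iota> i \<in> Ar C \<and> Dom C (\<iota> i) = X i \<and> Cod C (\<iota> i) = M \<and> \<pi> i \<in> Ar C \<and> Dom C (\<pi> i) = M \<and> Cod C (\<pi> i) = X i
     \<and> \<pi> i \<cdot> \<iota> i = Idt C (X i)" if "i \<in> {1..2}" for i
    using s that unfolding is_direct_sum_def by auto
  have "finprod (arrow_group C M M) (\<lambda>i. \<iota> i \<cdot> \<pi> i) {1..2} = Plus C (\<iota> 1 \<cdot> \<pi> 1) (\<iota> 2 \<cdot> \<pi> 2)"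
    using ty[of 1] ty[of 2] by (intro direct_sum_pair) auto
  then have "Plus C (\<iota> 1 \<cdot> \<pi> 1) (\<iota> 2 \<cdot> \<pi> 2) = Idt C M"
    using s unfolding is_direct_sum_def by auto
  then have "splitting M (\<iota> 1) (\<pi> 1) (\<iota> 2) (\<pi> 2)"
    using ty[of 1] ty[of 2] unfolding splitting_def by auto
  then show "\<exists>t s' t'. splitting M d t s' t'" unfolding d by blast
next
  assume "\<exists>t s' t'. splitting M d t s' t'"
  then obtain t s' t' where sp: "splitting M d t s' t'" by blast
  note d = splittingD[OF sp]
  have M: "M \<in> Ob C" using d by auto
  define X where "X = (\<lambda>i::nat. if i = 1 then Dom C d else Dom C s')"
  define \<iota> where "\<iota> = (\<lambda>i::nat. if i = 1 then d else s')"
  define \<pi> where "\<pi> = (\<lambda>i::nat. if i = 1 then t else t')"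
  have I: "{1..2::nat} = {1,2}" by auto
  have z: "t' \<cdot> d = Zero C (Dom C d) (Dom C s')" "t \<cdot> s' = Zero C (Dom C s') (Dom C d)"
    using splitting_zero[OF sp] splitting_zero[OF splitting_sym[OF sp]] d(1-12) by (auto simp: is_zero_arrow_def)
  have "finprod (arrow_group C M M) (\<lambda>i. \<iota> i \<cdot> \<pi> i) {1..2} = Plus C (d \<cdot> t) (s' \<cdot> t')"
    using d(1-12) by (intro direct_sum_pair) (auto simp: \<iota>_def \<pi>_def)
  then have "finprod (arrow_group C M M) (\<lambda>i. \<iota> i \<cdot> \<pi> i) {1..2} = Idt C M" using d(13) by simp
  then have "is_direct_sum C {1..2} X M \<iota> \<pi>"
    unfolding is_direct_sum_def using M d(1-12) z by (auto simp: I X_def \<iota>_def \<pi>_def)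
  then show "is_direct_summand C M d"
    unfolding is_direct_summand_def by (intro exI[of _ X] exI[of _ \<iota>] exI[of _ \<pi>]) (auto simp: \<iota>_def)
qed

text \<open>The complement \<open>e' = 1 - e\<close> is idempotent too, and splitting
  \<open>e\<close> and \<open>e'\<close> separately gives the two summands.\<close>

lemma idempotent_splitting:
  assumes e: "e \<in> Ar C" "Dom C e = M" "Cod C e = M" "e \<cdot> e = e"
  obtains s t s' t' where "splitting M s t s' t'" "s \<cdot> t = e"
proof -
  have M: "M \<in> Ob C" using e by auto
  obtain e' where e': "e' \<in> Ar C" "Dom C e' = M" "Cod C e' = M" "Plus C e e' = Idt C M"
    using ex_difference[of e "Idt C M"] e M by auto
  have "Plus C e (e \<cdot> e') = e \<cdot> Plus C e e'" using e e'(1-3) by simp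
  also have "\<dots> = e" unfolding e'(4) using e by simp
  finally have z: "is_zero_arrow C (e \<cdot> e')"
    by (rule plus_eq_self_imp_zero) (use e e'(1-3) in auto)
  have "e' = Plus C e e' \<cdot> e'" unfolding e'(4) using e' by simp
  also have "\<dots> = Plus C (e \<cdot> e') (e' \<cdot> e')" using e e'(1-3) by simp
  also have "\<dots> = e' \<cdot> e'" using z e e'(1-3) by simp
  finally have "e' \<cdot> e' = e'" ..
  then obtain s' t' where st': "s' \<in> Ar C" "t' \<in> Ar C" "Cod C s' = M" "Dom C t' = M" "Cod C t' = Dom C s'"
    "s' \<cdot> t' = e'" "t' \<cdot> s' = Idt C (Dom C s')"
    using split_idempotent[OF e'(1-3)] by blast
  obtain s t where st: "s \<in> Ar C" "t \<in> Ar C" "Cod C s = M" "Dom C t = M" "Cod C t = Dom C s"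
    "s \<cdot> t = e" "t \<cdot> s = Idt C (Dom C s)"
    using split_idempotent[OF e] by blast
  have "splitting M s t s' t'" unfolding splitting_def using st st' e' by auto
  then show thesis using that st by blast
qed

text \<open>If \<open>h s = s \<alpha>\<close> then \<open>s t\<close> fixes \<open>h s t\<close>,
  because \<open>t s = 1\<close>. Conversely, invariance of \<open>s t\<close> gives
  \<open>h s = s (t h s)\<close>, so \<open>t h s\<close> serves as \<open>\<alpha>\<close>.\<close>

lemma fully_invariant_iff:
  assumes sp: "splitting M s t s' t'"
  shows "is_fully_invariant C M s \<longleftrightarrow> invariant_idempotent C M (s \<cdot> t)"
proof
  note d = splittingD[OF sp]
  assume fi: "is_fully_invariant C M s"
  show "invariant_idempotent C M (s \<cdot> t)"
    unfolding invariant_idempotent_def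
  proof
    fix h assume h: "h \<in> arrows C M M"
    then obtain \<alpha> where a: "\<alpha> \<in> Ar C" "Dom C \<alpha> = Dom C s" "Cod C \<alpha> = Dom C s" "h \<cdot> s = s \<cdot> \<alpha>"
      using fi unfolding is_fully_invariant_def by (metis in_arrows_iff)
    have hst: "h \<cdot> (s \<cdot> t) = s \<cdot> (\<alpha> \<cdot> t)"
      using comp_cong_left[OF a(4), of t] a(1-3) h d(1-12) by simp
    show "(s \<cdot> t) \<cdot> (h \<cdot> (s \<cdot> t)) = h \<cdot> (s \<cdot> t)"
      unfolding hst using a(1-3) d(1-12) splitting_retract[OF sp] by simp
  qed
next
  note d = splittingD[OF sp]
  assume inv: "invariant_idempotent C M (s \<cdot> t)"
  show "is_fully_invariant C M s"
    unfolding is_fully_invariant_def is_subobject_def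
  proof (intro conjI ballI splitting_mono[OF sp] d)
    fix h assume h: "h \<in> arrows C M M"
    have "h \<cdot> s = (h \<cdot> (s \<cdot> t)) \<cdot> s" using h d(1-12) by simp
    also have "\<dots> = ((s \<cdot> t) \<cdot> (h \<cdot> (s \<cdot> t))) \<cdot> s" using inv h unfolding invariant_idempotent_def by metis
    also have "\<dots> = s \<cdot> (t \<cdot> (h \<cdot> s))" using h d(1-12) by simp
    finally show "\<exists>\<alpha>\<in>arrows C (Dom C s) (Dom C s). h \<cdot> s = s \<cdot> \<alpha>"
      using h d(1-12) by (intro bexI[of _ "t \<cdot> (h \<cdot> s)"]) auto
  qed
qed

text \<open>The image of \<open>s\<close> is the kernel of the complementary idempotent
  \<open>s' t'\<close>. Both sides say that \<open>s' t' h s\<close> vanishes for every endomorphism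
  \<open>h\<close>.\<close>

lemma fully_invariant_iff_opp:
  assumes sp: "splitting M s t s' t'"
  shows "is_fully_invariant C M s \<longleftrightarrow> invariant_idempotent (opp C) M (s' \<cdot> t')"
proof
  note d = splittingD[OF sp]
  assume fi: "is_fully_invariant C M s"
  show "invariant_idempotent (opp C) M (s' \<cdot> t')"
    unfolding invariant_idempotent_def
  proof
    fix h assume "h \<in> arrows (opp C) M M"
    then have h: "h \<in> arrows C M M" by simp
    then obtain \<alpha> where a: "\<alpha> \<in> Ar C" "Dom C \<alpha> = Dom C s" "Cod C \<alpha> = Dom C s" "h \<cdot> s = s \<cdot> \<alpha>"
      using fi unfolding is_fully_invariant_def by (metis in_arrows_iff)
    have "is_zero_arrow C (t' \<cdot> (h \<cdot> s))"
      unfolding a(4) by (rule comp_zero_left_assoc[OF splitting_zero[OF sp]]) (use a(1-3) d(1-12) in auto)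
    then have "is_zero_arrow C (s' \<cdot> ((t' \<cdot> (h \<cdot> s)) \<cdot> t))"
      by (rule comp_zero_right[OF comp_zero_left]) (use h d(1-12) in auto)
    then have z: "is_zero_arrow C (((s' \<cdot> t') \<cdot> h) \<cdot> (s \<cdot> t))"
      using h d(1-12) by simp
    have "Plus C (((s' \<cdot> t') \<cdot> h) \<cdot> (s \<cdot> t)) (((s' \<cdot> t') \<cdot> h) \<cdot> (s' \<cdot> t')) = (s' \<cdot> t') \<cdot> h"
      using h d(1-12) by (intro splitting_decomp_right[OF sp]) auto
    moreover have "Plus C (((s' \<cdot> t') \<cdot> h) \<cdot> (s \<cdot> t)) (((s' \<cdot> t') \<cdot> h) \<cdot> (s' \<cdot> t')) = ((s' \<cdot> t') \<cdot> h) \<cdot> (s' \<cdot> t')"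
      using h d(1-12) by (intro plus_zero(1)[OF z]) auto
    ultimately show "s' \<cdot> t' \<cdot>\<^bsub>opp C\<^esub> (h \<cdot>\<^bsub>opp C\<^esub> (s' \<cdot> t')) = h \<cdot>\<^bsub>opp C\<^esub> (s' \<cdot> t')"
      by simp
  qed
next
  note d = splittingD[OF sp]
  assume inv: "invariant_idempotent (opp C) M (s' \<cdot> t')"
  show "is_fully_invariant C M s"
    unfolding is_fully_invariant_def is_subobject_def
  proof (intro conjI ballI splitting_mono[OF sp] d)
    fix h assume h: "h \<in> arrows C M M"
    have "((s' \<cdot> t') \<cdot> h) \<cdot> (s' \<cdot> t') = (s' \<cdot> t') \<cdot> h"
      using inv h unfolding invariant_idempotent_def by simp
    then have "((s' \<cdot> t') \<cdot> h) \<cdot> s = (((s' \<cdot> t') \<cdot> h) \<cdot> (s' \<cdot> t')) \<cdot> s" by simp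
    then have eq: "s' \<cdot> (t' \<cdot> (h \<cdot> s)) = s' \<cdot> (t' \<cdot> (h \<cdot> (s' \<cdot> (t' \<cdot> s))))"
      using h d(1-12) by simp
    have "is_zero_arrow C (s' \<cdot> (t' \<cdot> (h \<cdot> s)))"
      unfolding eq using splitting_zero[OF sp] h d(1-12) by simp
    then have "Plus C (s \<cdot> (t \<cdot> (h \<cdot> s))) (s' \<cdot> (t' \<cdot> (h \<cdot> s))) = s \<cdot> (t \<cdot> (h \<cdot> s))"
      by (rule plus_zero(2)) (use h d(1-12) in auto)
    then have "h \<cdot> s = s \<cdot> (t \<cdot> (h \<cdot> s))"
      using splitting_decomp[OF sp, of "h \<cdot> s"] h d(1-12) by simp
    then show "\<exists>\<alpha>\<in>arrows C (Dom C s) (Dom C s). h \<cdot> s = s \<cdot> \<alpha>"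
      using h d(1-12) by (intro bexI[of _ "t \<cdot> (h \<cdot> s)"]) auto
  qed
qed

end

section \<open>CS-Baer objects through idempotents\<close>

text \<open>The flag \<open>b\<close> selects the strong version.\<close>

definition hull_Baer :: "'u rel \<Rightarrow> bool \<Rightarrow> ('o, 'a) additive_category_data \<Rightarrow> 'o \<Rightarrow> 'o \<Rightarrow> bool" where
  "hull_Baer \<kappa> b C M N \<longleftrightarrow>
     (\<forall>(I :: 'u set) f. small \<kappa> I \<and> (\<forall>i\<in>I. f i \<in> arrows C M N) \<longrightarrow>
        (\<exists>e. summand_hull C M (annihilated C M (f ` I)) e \<and> (b \<longrightarrow> invariant_idempotent C M e)))"

section \<open>Direct sums as targets, and translation of the CS-Baer notions into
  idempotents\<close>

context abelian_category
begin

text \<open>Composing \<open>g\<close> with the identity, written as the sum of all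
  \<open>\<iota> i \<cdot> \<pi> i\<close>, gives a sum of zero arrows. Since the sum is a
  \<open>finprod\<close>, the claim is proved for partial sums over subsets
  \<open>B\<close>.\<close>

lemma direct_sum_jointly_mono:
  assumes ds: "is_direct_sum C A X S \<iota> \<pi>" and g: "g \<in> Ar C" "Cod C g = S"
    and z: "\<And>i. i \<in> A \<Longrightarrow> is_zero_arrow C (\<pi> i \<cdot> g)"
  shows "is_zero_arrow C g"
proof -
  have S: "S \<in> Ob C" using g by auto
  interpret G: comm_group "arrow_group C S S" by (rule arrow_group[OF S S])
  let ?F = "finprod (arrow_group C S S) (\<lambda>i. \<iota> i \<cdot> \<pi> i)"
  have ty: "\<iota> i \<in> Ar C" "Cod C (\<iota> i) = S" "\<pi> i \<in> Ar C" "Dom C (\<pi> i) = S" "Cod C (\<pi> i) = Dom C (\<iota> i)"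
    if "i \<in> A" for i
    using ds that unfolding is_direct_sum_def by auto
  have fin: "finite A" using ds unfolding is_direct_sum_def by auto
  have "?F B \<in> arrows C S S \<and> is_zero_arrow C (?F B \<cdot> g)" if "B \<subseteq> A" for B
    using finite_subset[OF that fin] that
  proof (induction B rule: finite_induct)
    case empty
    have "?F {} = Zero C S S" using G.finprod_empty by (simp add: arrow_group_def)
    then show ?case using S g by simp
  next
    case (insert i B)
    then have IH: "?F B \<in> arrows C S S" "is_zero_arrow C (?F B \<cdot> g)" and i: "i \<in> A" by auto
    have car: "\<iota> j \<cdot> \<pi> j \<in> carrier (arrow_group C S S)" if "j \<in> insert i B" for j
      using ty[of j] that insert.prems by (auto simp: arrow_group_def)
    have "?F (insert i B) = (\<iota> i \<cdot> \<pi> i) \<otimes>\<^bsub>arrow_group C S S\<^esub> ?F B"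
      using insert.hyps car by (intro G.finprod_insert) auto
    then have eq: "?F (insert i B) = Plus C (\<iota> i \<cdot> \<pi> i) (?F B)" by (simp add: arrow_group_def)
    have "is_zero_arrow C (\<iota> i \<cdot> (\<pi> i \<cdot> g))" using z[OF i] ty[OF i] g by simp
    then show ?case unfolding eq using IH ty[OF i] g by simp
  qed
  from this[of A] have "is_zero_arrow C (Idt C S \<cdot> g)"
    using ds unfolding is_direct_sum_def by simp
  then show ?thesis using g by simp
qed

text \<open>Base case of the induction: the empty family has all of \<open>M\<close> as common
  kernel, and the essentiality condition is settled by taking the identity for
  \<open>y\<close>.\<close>

lemma summand_hull_identity:
  assumes M: "M \<in> Ob C"
  shows "summand_hull C M (annihilated C M {}) (Idt C M)"
  unfolding summand_hull_def
proof (intro conjI allI impI)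
  show "\<exists>m\<in>annihilated C M {}. is_mono C m \<and> (\<forall>x\<in>annihilated C M {}. subobject_le C x m)"
  proof (intro bexI[of _ "Idt C M"] conjI ballI mono_idt[OF M])
    fix x assume "x \<in> annihilated C M {}"
    then show "subobject_le C x (Idt C M)"
      using M unfolding annihilated_def subobject_le_def by auto
  qed (use M in \<open>auto simp: annihilated_def\<close>)
next
  fix x assume x: "is_mono C x \<and> Cod C x = M \<and> Idt C M \<cdot> x = x \<and>
    (\<forall>y\<in>Ar C. Cod C y = Dom C x \<and> x \<cdot> y \<in> annihilated C M {} \<longrightarrow> is_zero_arrow C (x \<cdot> y))"
  then have xa: "x \<in> Ar C" by simp
  from x have "\<forall>y\<in>Ar C. Cod C y = Dom C x \<and> x \<cdot> y \<in> annihilated C M {} \<longrightarrow> is_zero_arrow C (x \<cdot> y)"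
    by blast
  from bspec[OF this, of "Idt C (Dom C x)"] have "is_zero_arrow C (x \<cdot> Idt C (Dom C x))"
    using x xa by (simp add: annihilated_def)
  then show "is_zero_arrow C x" using xa by simp
qed (use M in \<open>auto simp: annihilated_def\<close>)

text \<open>From \<open>S\<close> to \<open>X i\<close>, composing a family with the monomorphism
  \<open>\<iota> i\<close> leaves its annihilator unchanged. In the other direction a family into
  \<open>S\<close> is split into components, and one summand at a time is added by
  \<open>summand_hull_inter\<close>.\<close>

lemma hull_Baer_direct_sum:
  fixes \<kappa> :: "'u rel"
  assumes ds: "is_direct_sum C A X S \<iota> \<pi>" and M: "M \<in> Ob C"
  shows "hull_Baer \<kappa> b C M S \<longleftrightarrow> (\<forall>i\<in>A. hull_Baer \<kappa> b C M (X i))"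
proof (intro iffI ballI)
  have ty: "\<iota> i \<in> Ar C" "Dom C (\<iota> i) = X i" "Cod C (\<iota> i) = S" "\<pi> i \<in> Ar C" "Dom C (\<pi> i) = S"
    "Cod C (\<pi> i) = X i" "\<pi> i \<cdot> \<iota> i = Idt C (X i)" if "i \<in> A" for i
    using ds that unfolding is_direct_sum_def by auto
  have fin: "finite A" using ds unfolding is_direct_sum_def by auto
  {
    fix i assume hS: "hull_Baer \<kappa> b C M S" and i: "i \<in> A"
    show "hull_Baer \<kappa> b C M (X i)"
      unfolding hull_Baer_def
    proof (intro allI impI, elim conjE)
      fix I :: "'u set" and f assume I: "small \<kappa> I" and f: "\<forall>j\<in>I. f j \<in> arrows C M (X i)"
      have mi: "is_mono C (\<iota> i)" using ty[OF i] by (intro split_mono[of "\<pi> i"]) auto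
      have "annihilated C M ((\<lambda>j. \<iota> i \<cdot> f j) ` I) = annihilated C M (f ` I)"
      proof -
        have "is_zero_arrow C ((\<iota> i \<cdot> f j) \<cdot> x) \<longleftrightarrow> is_zero_arrow C (f j \<cdot> x)"
          if "j \<in> I" "x \<in> Ar C" "Cod C x = M" for j x
          using mono_zero[OF mi, of "f j \<cdot> x"] f that ty[OF i] by auto
        then show ?thesis unfolding annihilated_def by auto
      qed
      moreover have "\<exists>e. summand_hull C M (annihilated C M ((\<lambda>j. \<iota> i \<cdot> f j) ` I)) e \<and> (b \<longrightarrow> invariant_idempotent C M e)"
        using hS[unfolded hull_Baer_def, rule_format, of I "\<lambda>j. \<iota> i \<cdot> f j"] I f ty[OF i] by auto
      ultimately show "\<exists>e. summand_hull C M (annihilated C M (f ` I)) e \<and> (b \<longrightarrow> invariant_idempotent C M e)"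
        by simp
    qed
  next
    assume hX: "\<forall>i\<in>A. hull_Baer \<kappa> b C M (X i)"
    show "hull_Baer \<kappa> b C M S"
      unfolding hull_Baer_def
    proof (intro allI impI, elim conjE)
      fix I :: "'u set" and f assume I: "small \<kappa> I" and f: "\<forall>j\<in>I. f j \<in> arrows C M S"
      have "\<exists>e. summand_hull C M (annihilated C M (\<Union>i\<in>B. (\<lambda>j. \<pi> i \<cdot> f j) ` I)) e \<and> (b \<longrightarrow> invariant_idempotent C M e)"
        if "B \<subseteq> A" for B
        using finite_subset[OF that fin] that
      proof (induction B rule: finite_induct)
        case empty
        have "invariant_idempotent C M (Idt C M)" using M unfolding invariant_idempotent_def by auto
        then show ?case using summand_hull_identity[OF M] by auto
      next
        case (insert i B)
        let ?G1 = "(\<lambda>j. \<pi> i \<cdot> f j) ` I" and ?G2 = "\<Union>i\<in>B. (\<lambda>j. \<pi> i \<cdot> f j) ` I"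
        from insert obtain e2 where h2: "summand_hull C M (annihilated C M ?G2) e2"
          and i2: "b \<Longrightarrow> invariant_idempotent C M e2" by auto
        have e2: "e2 \<in> arrows C M M" using summand_hullD(1)[OF h2] .
        have i: "i \<in> A" using insert by auto
        \<comment> \<open>The twisted family keeps the index set \<open>I\<close>, so it is again
          small and the hypothesis on \<open>X i\<close> applies.\<close>
        have "\<forall>j\<in>I. (\<pi> i \<cdot> f j) \<cdot> e2 \<in> arrows C M (X i)" using f e2 ty[OF i] by auto
        with hX i I obtain e where "summand_hull C M (annihilated C M ((\<lambda>j. (\<pi> i \<cdot> f j) \<cdot> e2) ` I)) e"
          and i1: "b \<Longrightarrow> invariant_idempotent C M e" unfolding hull_Baer_def by metis
        then have h1: "summand_hull C M (annihilated C M ((\<lambda>g. g \<cdot> e2) ` ?G1)) e"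
          by (simp add: image_image)
        have G1: "g \<in> Ar C \<and> Dom C g = M" if "g \<in> ?G1" for g
          using that f ty[OF i] by auto
        have G2: "g \<in> Ar C \<and> Dom C g = M" if "g \<in> ?G2" for g
          using that f ty insert.prems by auto
        have "?G1 \<union> ?G2 = (\<Union>i\<in>insert i B. (\<lambda>j. \<pi> i \<cdot> f j) ` I)" by auto
        then show ?case
          using summand_hull_inter[OF G1 G2 h2 h1] i1 i2 by metis
      qed
      from this[of A] have "\<exists>e. summand_hull C M (annihilated C M (\<Union>i\<in>A. (\<lambda>j. \<pi> i \<cdot> f j) ` I)) e
        \<and> (b \<longrightarrow> invariant_idempotent C M e)" by simp
      moreover have "annihilated C M (\<Union>i\<in>A. (\<lambda>j. \<pi> i \<cdot> f j) ` I) = annihilated C M (f ` I)"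
      proof -
        have "(\<forall>i\<in>A. is_zero_arrow C ((\<pi> i \<cdot> f j) \<cdot> x)) \<longleftrightarrow> is_zero_arrow C (f j \<cdot> x)"
          if "j \<in> I" "x \<in> Ar C" "Cod C x = M" for j x
          using direct_sum_jointly_mono[OF ds, of "f j \<cdot> x"] f that ty by auto
        then show ?thesis unfolding annihilated_def by auto
      qed
      ultimately show "\<exists>e. summand_hull C M (annihilated C M (f ` I)) e \<and> (b \<longrightarrow> invariant_idempotent C M e)"
        by simp
    qed
  }
qed

text \<open>An arrow factors through a kernel of \<open>f i\<close> exactly when \<open>f i\<close>
  kills it, so lying below all the kernels is membership in \<open>annihilated\<close>. Maximality
  among monomorphisms extends to all arrows by \<open>intersection_universal\<close>.\<close>

lemma intersection_kernels_iff:
  assumes f: "\<forall>i\<in>I. f i \<in> arrows C M N"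
  shows "is_intersection C M {k. \<exists>i\<in>I. is_kernel C k (f i)} m \<longleftrightarrow>
    is_mono C m \<and> m \<in> annihilated C M (f ` I) \<and> (\<forall>x\<in>annihilated C M (f ` I). subobject_le C x m)"
    (is "?L \<longleftrightarrow> ?R")
proof -
  have le_iff: "subobject_le C x k \<longleftrightarrow> is_zero_arrow C (f i \<cdot> x)"
    if "i \<in> I" "is_kernel C k (f i)" "x \<in> Ar C" "Cod C x = M" for i k x
  proof
    note k = kernelD[OF that(2)]
    assume "subobject_le C x k"
    then obtain u where u: "u \<in> Ar C" "Dom C u = Dom C x" "Cod C u = Dom C k" "k \<cdot> u = x"
      by (rule subobject_leE)
    have "is_zero_arrow C (f i \<cdot> (k \<cdot> u))" using k u by (intro comp_zero_left_assoc) auto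
    then show "is_zero_arrow C (f i \<cdot> x)" using u by simp
  next
    assume "is_zero_arrow C (f i \<cdot> x)"
    then show "subobject_le C x k" using bspec[OF f that(1)] that by (intro kernel_universal[OF that(2)]) auto
  qed
  \<comment> \<open>Kernels enter the family as all arrows satisfying \<open>is_kernel\<close>;
    without existence, an index would impose no condition.\<close>
  have ex: "\<exists>k. is_kernel C k (f i)" if "i \<in> I" for i
    using kernels bspec[OF f that] by auto
  have ann: "(\<forall>k\<in>{k. \<exists>i\<in>I. is_kernel C k (f i)}. subobject_le C x k) \<longleftrightarrow> x \<in> annihilated C M (f ` I)"
    if "x \<in> Ar C" "Cod C x = M" for x
    using that le_iff ex unfolding annihilated_def by blast
  show ?thesis
  proof
    assume L: ?L
    then have m: "is_mono C m" "Cod C m = M" "\<forall>k\<in>{k. \<exists>i\<in>I. is_kernel C k (f i)}. subobject_le C m k"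
      unfolding is_intersection_def is_subobject_def by auto
    have "subobject_le C x m" if x: "x \<in> annihilated C M (f ` I)" for x
    proof (rule intersection_universal[OF L])
      have xx: "x \<in> Ar C" "Cod C x = M" using x unfolding annihilated_def by auto
      then show "x \<in> Ar C" "Cod C x = M" by auto
      fix k assume k: "k \<in> {k. \<exists>i\<in>I. is_kernel C k (f i)}"
      then show "is_mono C k \<and> subobject_le C x k"
        using kernel_mono ann[OF xx] x by blast
    qed
    then show ?R using ann[of m] m by auto
  next
    assume R: ?R
    then have "m \<in> Ar C" "Cod C m = M" unfolding annihilated_def by auto
    then show ?L unfolding is_intersection_def is_subobject_def using R ann by auto
  qed
qed

lemma ex_intersection_pair:
  assumes a: "is_mono C a" and b: "is_mono C b" and ab: "Cod C a = Cod C b"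
  obtains z where "is_intersection C (Cod C a) {a, b} z"
proof -
  obtain z where "is_mono C z" "Cod C z = Cod C a" "subobject_le C z a" "subobject_le C z b"
    "\<And>h. \<lbrakk>h \<in> Ar C; Cod C h = Cod C a; subobject_le C h a; subobject_le C h b\<rbrakk> \<Longrightarrow> subobject_le C h z"
    using ex_binary_intersection[OF assms] by metis
  then have "is_intersection C (Cod C a) {a, b} z"
    unfolding is_intersection_def is_subobject_def by auto
  then show thesis by (rule that)
qed

text \<open>The summand \<open>d\<close> and the idempotent \<open>d \<cdot> t\<close> determine
  each other. Subobjects \<open>x\<close> of \<open>M\<close> fixed by the idempotent correspond to
  subobjects of the summand through composition with \<open>t\<close> and with the inclusion, which
  matches the two forms of essentiality.\<close>

lemma essential_summand_iff_hull:
  assumes f: "\<forall>i\<in>I. f i \<in> arrows C M N"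
  shows "(\<exists>m d. is_intersection C M {k. \<exists>i\<in>I. is_kernel C k (f i)} m \<and> is_direct_summand C M d \<and>
            (b \<longrightarrow> is_fully_invariant C M d) \<and> essential_in C m d) \<longleftrightarrow>
         (\<exists>e. summand_hull C M (annihilated C M (f ` I)) e \<and> (b \<longrightarrow> invariant_idempotent C M e))"
    (is "?L \<longleftrightarrow> ?R")
proof
  let ?K = "annihilated C M (f ` I)"
  assume ?L
  then obtain m d where int: "is_intersection C M {k. \<exists>i\<in>I. is_kernel C k (f i)} m"
    and ds: "is_direct_summand C M d" and fi: "b \<longrightarrow> is_fully_invariant C M d" and ess: "essential_in C m d"
    by blast
  have m: "is_mono C m" "m \<in> ?K" "\<forall>x\<in>?K. subobject_le C x m"
    using int unfolding intersection_kernels_iff[where I = I and f = f and N = N, OF f] by auto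
  obtain t s' t' where sp: "splitting M d t s' t'" using ds direct_summand_iff_splitting by blast
  note d = splittingD[OF sp]
  obtain u where u: "u \<in> Ar C" "Dom C u = Dom C m" "Cod C u = Dom C d" "d \<cdot> u = m" "is_essential C u"
    using ess unfolding essential_in_def by auto
  have "summand_hull C M ?K (d \<cdot> t)"
    unfolding summand_hull_def
  proof (intro conjI allI impI ballI)
    show "\<exists>m\<in>?K. is_mono C m \<and> (\<forall>x\<in>?K. subobject_le C x m)" using m by blast
    show "(d \<cdot> t) \<cdot> (d \<cdot> t) = d \<cdot> t" using d(1-12) splitting_retract[OF sp] by simp
    show "d \<cdot> t \<in> arrows C M M" using d by simp
  next
    fix x assume "x \<in> ?K"
    then have "subobject_le C x m" using m by blast
    then obtain v where v: "v \<in> Ar C" "Dom C v = Dom C x" "Cod C v = Dom C m" "m \<cdot> v = x"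
      by (rule subobject_leE)
    have x: "d \<cdot> (u \<cdot> v) = x" using comp_cong_left[OF u(4), of v] u(1-3) v d(1-12) by simp
    have "(d \<cdot> t) \<cdot> (d \<cdot> (u \<cdot> v)) = d \<cdot> (u \<cdot> v)"
      using splitting_retract[OF sp, of "u \<cdot> v"] u(1-3) v(1-3) d(1-12) by simp
    then show "(d \<cdot> t) \<cdot> x = x" unfolding x .
  next
    fix x assume "is_mono C x \<and> Cod C x = M \<and> (d \<cdot> t) \<cdot> x = x \<and>
      (\<forall>y\<in>Ar C. Cod C y = Dom C x \<and> x \<cdot> y \<in> ?K \<longrightarrow> is_zero_arrow C (x \<cdot> y))"
    then have x: "is_mono C x" "Cod C x = M" "(d \<cdot> t) \<cdot> x = x" and
      xy: "\<And>y. \<lbrakk>y \<in> Ar C; Cod C y = Dom C x; x \<cdot> y \<in> ?K\<rbrakk> \<Longrightarrow> is_zero_arrow C (x \<cdot> y)"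
      by auto
    have dtx: "d \<cdot> (t \<cdot> x) = x" using x d(1-12) by simp
    have mtx: "is_mono C (t \<cdot> x)" by (rule mono_factor[of d]) (use dtx x d(1-12) in auto)
    have um: "is_mono C u" using u(5) unfolding is_essential_def by auto
    \<comment> \<open>The intersection \<open>z\<close> factors both as \<open>u \<cdot> v\<close>
      and as \<open>(t \<cdot> x) \<cdot> y\<close>. Composed with \<open>d\<close> it equals
      \<open>m \<cdot> v\<close>, hence lies in \<open>?K\<close>, and also
      \<open>x \<cdot> y\<close>, hence vanishes.\<close>
    obtain z where z: "is_intersection C (Cod C u) {u, t \<cdot> x} z"
      using ex_intersection_pair[OF um mtx] u(3) x d(1-12) by auto
    then have zm: "is_mono C z" "Cod C z = Dom C d" "subobject_le C z u" "subobject_le C z (t \<cdot> x)"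
      using u(3) unfolding is_intersection_def is_subobject_def by auto
    obtain v where v: "v \<in> Ar C" "Dom C v = Dom C z" "Cod C v = Dom C u" "u \<cdot> v = z"
      using zm(3) by (rule subobject_leE)
    obtain y where y: "y \<in> Ar C" "Dom C y = Dom C z" "Cod C y = Dom C (t \<cdot> x)" "(t \<cdot> x) \<cdot> y = z"
      using zm(4) by (rule subobject_leE)
    have yx: "Cod C y = Dom C x" using y x d(1-12) by simp
    have mv: "m \<cdot> v = d \<cdot> z" using comp_cong_left[OF u(4), of v] u(1-3) v d(1-12) by simp
    have xyz: "x \<cdot> y = d \<cdot> z" using comp_cong_left[OF dtx, of y] y yx x(1,2) d(1-12) by simp
    have "m \<cdot> v \<in> ?K" using f v u(2) by (intro annihilated_comp[OF m(2)]) auto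
    then have "is_zero_arrow C (x \<cdot> y)" using xy[OF y(1) yx] mv xyz by simp
    then have "is_zero_arrow C (d \<cdot> z)" unfolding xyz .
    then have "is_zero_arrow C z" by (rule mono_zero[OF splitting_mono[OF sp]]) (use zm in auto)
    moreover have "is_subobject C (Cod C u) (t \<cdot> x)"
      unfolding is_subobject_def using mtx u(3) x d(1-12) by simp
    ultimately have "is_zero_arrow C (t \<cdot> x)" using u(5) z unfolding is_essential_def by blast
    then have "is_zero_arrow C (d \<cdot> (t \<cdot> x))" by (rule comp_zero_right) (use x d(1-12) in auto)
    then show "is_zero_arrow C x" unfolding dtx .
  qed
  then show ?R using fi fully_invariant_iff[OF sp] by blast
next
  let ?K = "annihilated C M (f ` I)"
  assume ?R
  then obtain e where h: "summand_hull C M ?K e" and inv: "b \<longrightarrow> invariant_idempotent C M e" by blast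
  have e: "e \<in> Ar C" "Dom C e = M" "Cod C e = M" "e \<cdot> e = e" using summand_hullD(1,2)[OF h] by auto
  obtain s t s' t' where sp: "splitting M s t s' t'" and st: "s \<cdot> t = e" using idempotent_splitting[OF e] .
  note d = splittingD[OF sp]
  obtain m where m: "m \<in> ?K" "is_mono C m" "\<forall>x\<in>?K. subobject_le C x m" using summand_hullD(4)[OF h] by blast
  have mM: "Cod C m = M" using m unfolding annihilated_def by auto
  have int: "is_intersection C M {k. \<exists>i\<in>I. is_kernel C k (f i)} m"
    unfolding intersection_kernels_iff[where I = I and f = f and N = N, OF f] using m by blast
  have stm: "s \<cdot> (t \<cdot> m) = m"
    using summand_hullD(3)[OF h m(1)] comp_cong_left[OF st, of m] m mM d(1-12) by simp
  have um: "is_mono C (t \<cdot> m)" by (rule mono_factor[of s]) (use stm m mM d(1-12) in auto)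
  have cod: "Cod C (t \<cdot> m) = Dom C s" using mM m d(1-12) by simp
  have "is_essential C (t \<cdot> m)"
    unfolding is_essential_def cod
  proof (intro conjI um allI impI, elim conjE exE)
    fix x z assume "is_subobject C (Dom C s) x" and z: "is_intersection C (Dom C s) {t \<cdot> m, x} z"
      and z0: "is_zero_arrow C z"
    then have x: "is_mono C x" "Cod C x = Dom C s" unfolding is_subobject_def by auto
    have "is_zero_arrow C (s \<cdot> x)"
    proof (rule summand_hullD(5)[OF h])
      show "is_mono C (s \<cdot> x)" using mono_comp[OF x(1) splitting_mono[OF sp]] x by simp
      show "Cod C (s \<cdot> x) = M" using x d(1-12) by simp
      show "e \<cdot> (s \<cdot> x) = s \<cdot> x"
        unfolding st[symmetric] using splitting_retract[OF sp mono_ar[OF x(1)] x(2)] x d(1-12) by simp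
      fix y assume y: "y \<in> Ar C" "Cod C y = Dom C (s \<cdot> x)" and K: "(s \<cdot> x) \<cdot> y \<in> ?K"
      have yx: "Cod C y = Dom C x" using y x d(1-12) by simp
      have "subobject_le C ((s \<cdot> x) \<cdot> y) m" using m K by blast
      then obtain v where v: "v \<in> Ar C" "Dom C v = Dom C ((s \<cdot> x) \<cdot> y)" "Cod C v = Dom C m" "m \<cdot> v = (s \<cdot> x) \<cdot> y"
        by (rule subobject_leE)
      have "s \<cdot> ((t \<cdot> m) \<cdot> v) = m \<cdot> v" using comp_cong_left[OF stm, of v] v(1,3) m mM d(1-12) by simp
      also have "\<dots> = s \<cdot> (x \<cdot> y)" unfolding v(4) using x y(1) yx d(1-12) by simp
      finally have eq: "(t \<cdot> m) \<cdot> v = x \<cdot> y"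
        by (rule mono_cancel[OF splitting_mono[OF sp]]) (use x y(1) yx d(1-12) v(1-3) m mM in auto)
      \<comment> \<open>\<open>x \<cdot> y\<close> may fail to be a monomorphism, so the universal
        property of \<open>z\<close> is used for arbitrary arrows.\<close>
      have "subobject_le C (x \<cdot> y) z"
      proof (rule intersection_universal[OF z])
        fix k assume "k \<in> {t \<cdot> m, x}"
        moreover have "subobject_le C (x \<cdot> y) (t \<cdot> m)"
          unfolding eq[symmetric] using v(1,3) m mM d(1-12) by (intro subobject_leI) auto
        moreover have "subobject_le C (x \<cdot> y) x" using x y(1) yx by (intro subobject_leI) auto
        ultimately show "is_mono C k \<and> subobject_le C (x \<cdot> y) k" using um x by auto
      qed (use x y(1) yx in auto)
      then obtain w where w: "w \<in> Ar C" "Cod C w = Dom C z" "z \<cdot> w = x \<cdot> y" by (auto elim: subobject_leE)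
      have "is_zero_arrow C (z \<cdot> w)" using z0 w(1,2) by simp
      then have "is_zero_arrow C (s \<cdot> (x \<cdot> y))"
        unfolding w(3) by (rule comp_zero_right) (use x y(1) yx d(1-12) in auto)
      then show "is_zero_arrow C ((s \<cdot> x) \<cdot> y)" using x y(1) yx d(1-12) by simp
    qed
    then show "is_zero_arrow C x" by (rule mono_zero[OF splitting_mono[OF sp]]) (use x in auto)
  qed
  then have "essential_in C m s"
    unfolding essential_in_def using stm m mM d(1-12) by (intro bexI[of _ "t \<cdot> m"]) auto
  moreover have "is_direct_summand C M s" using sp direct_summand_iff_splitting by blast
  moreover have "b \<longrightarrow> is_fully_invariant C M s" using inv fully_invariant_iff[OF sp] st by simp
  ultimately show ?L using int by blast
qed

lemma CS_Baer_iff: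
  fixes \<kappa> :: "'u rel"
  shows "CS_Baer \<kappa> C M N \<longleftrightarrow> hull_Baer \<kappa> False C M N"
proof -
  have "(\<exists>m d. is_intersection C M {k. \<exists>i\<in>I. is_kernel C k (f i)} m \<and> is_direct_summand C M d \<and> essential_in C m d) \<longleftrightarrow>
    (\<exists>e. summand_hull C M (annihilated C M (f ` I)) e)" if "\<forall>i\<in>I. f i \<in> arrows C M N" for I :: "'u set" and f
    using essential_summand_iff_hull[of I f M N False] that by auto
  then show ?thesis unfolding CS_Baer_def hull_Baer_def simp_thms
    by (intro iff_allI imp_cong refl) blast
qed

lemma strongly_CS_Baer_iff:
  fixes \<kappa> :: "'u rel"
  shows "strongly_CS_Baer \<kappa> C M N \<longleftrightarrow> hull_Baer \<kappa> True C M N"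
proof -
  have "(\<exists>m d. is_intersection C M {k. \<exists>i\<in>I. is_kernel C k (f i)} m \<and> is_direct_summand C M d \<and>
      is_fully_invariant C M d \<and> essential_in C m d) \<longleftrightarrow>
    (\<exists>e. summand_hull C M (annihilated C M (f ` I)) e \<and> invariant_idempotent C M e)"
    if "\<forall>i\<in>I. f i \<in> arrows C M N" for I :: "'u set" and f
    using essential_summand_iff_hull[of I f M N True] that by auto
  then show ?thesis unfolding strongly_CS_Baer_def hull_Baer_def simp_thms
    by (intro iff_allI imp_cong refl) blast
qed

section \<open>The dual notions\<close>

lemma opp_subobject_le: "subobject_le (opp C) x m \<longleftrightarrow> (\<exists>u\<in>arrows C (Cod C m) (Cod C x). u \<cdot> m = x)"
  unfolding subobject_le_def by simp

lemma opp_annihilated: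
  "annihilated (opp C) N G = {x \<in> Ar C. Dom C x = N \<and> (\<forall>g\<in>G. is_zero_arrow C (x \<cdot> g))}"
  unfolding annihilated_def by simp

lemma opp_summand_hull:
  "summand_hull (opp C) N K e \<longleftrightarrow> e \<in> arrows C N N \<and> e \<cdot> e = e \<and> (\<forall>x\<in>K. x \<cdot> e = x) \<and>
     (\<exists>m\<in>K. is_epi C m \<and> (\<forall>x\<in>K. \<exists>u\<in>arrows C (Cod C m) (Cod C x). u \<cdot> m = x)) \<and>
     (\<forall>x. is_epi C x \<and> Dom C x = N \<and> x \<cdot> e = x \<and>
          (\<forall>y\<in>Ar C. Dom C y = Cod C x \<and> y \<cdot> x \<in> K \<longrightarrow> is_zero_arrow C (y \<cdot> x))
          \<longrightarrow> is_zero_arrow C x)"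
  unfolding summand_hull_def by (simp add: opp_subobject_le)

lemma ex_image: "f \<in> Ar C \<Longrightarrow> \<exists>m. is_image C m f"
  unfolding is_image_def using cokernels kernels cokernelD(2) by metis

text \<open>The image is the kernel of the cokernel \<open>q\<close> of \<open>f\<close>. An arrow
  killing \<open>f\<close> factors through \<open>q\<close> and so kills the image; conversely
  \<open>f\<close> factors through its image. Subobjects above an image thus turn into arrows that
  kill \<open>f\<close>.\<close>

lemma image_kernel_le:
  assumes m: "is_image C m f" and k: "is_kernel C k x" and x: "x \<in> Ar C" "Dom C x = Cod C f"
  shows "subobject_le C m k \<longleftrightarrow> is_zero_arrow C (x \<cdot> f)"
proof
  obtain q where q: "is_cokernel C q f" and mq: "is_kernel C m q" using m unfolding is_image_def by blast
  note q' = cokernelD[OF q] and m' = kernelD[OF mq] and k' = kernelD[OF k]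
  {
    assume "subobject_le C m k"
    then obtain u where u: "u \<in> Ar C" "Dom C u = Dom C m" "Cod C u = Dom C k" "k \<cdot> u = m" by (rule subobject_leE)
    have "subobject_le C f m" using q' by (intro kernel_universal[OF mq]) auto
    then obtain v where v: "v \<in> Ar C" "Dom C v = Dom C f" "Cod C v = Dom C m" "m \<cdot> v = f" by (rule subobject_leE)
    have f: "k \<cdot> (u \<cdot> v) = f" using comp_cong_left[OF u(4), of v] u(1-3) v k' by simp
    have "is_zero_arrow C (x \<cdot> (k \<cdot> (u \<cdot> v)))"
      by (rule comp_zero_left_assoc[OF k'(4)]) (use u(1-3) v(1-3) k' in auto)
    then show "is_zero_arrow C (x \<cdot> f)" unfolding f .
  next
    assume "is_zero_arrow C (x \<cdot> f)"
    then obtain y where y: "y \<in> Ar C" "Dom C y = Cod C q" "Cod C y = Cod C x" "y \<cdot> q = x"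
      using cokernel_universal[OF q x] by blast
    have "is_zero_arrow C (y \<cdot> (q \<cdot> m))" by (rule comp_zero_right) (use y(1-3) q' m' in auto)
    then have "is_zero_arrow C (x \<cdot> m)" using comp_cong_left[OF y(4), of m] y(1-3) q' m' by simp
    then show "subobject_le C m k" using x q' m' by (intro kernel_universal[OF k]) auto
  }
qed

text \<open>Every subobject is the kernel of some \<open>x\<close>, and it contains all the images
  exactly when \<open>x\<close> kills every \<open>f i\<close>. So the least upper bound
  \<open>l\<close> is recognised by its cokernel \<open>c\<close> killing the family while every
  other such arrow kills \<open>l\<close>.\<close>

lemma subobject_sum_images_iff:
  assumes f: "\<forall>i\<in>I. f i \<in> arrows C M N"
    and l: "is_kernel C l c" and c: "is_cokernel C c l" and N: "Cod C l = N"
  shows "is_subobject_sum C N {m. \<exists>i\<in>I. is_image C m (f i)} l \<longleftrightarrow>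
    c \<in> annihilated (opp C) N (f ` I) \<and> (\<forall>x\<in>annihilated (opp C) N (f ` I). is_zero_arrow C (x \<cdot> l))"
proof -
  let ?S = "{m. \<exists>i\<in>I. is_image C m (f i)}" and ?K = "annihilated (opp C) N (f ` I)"
  note l' = kernelD[OF l] and c' = cokernelD[OF c]
  have le: "(\<forall>m\<in>?S. subobject_le C m k) \<longleftrightarrow> x \<in> ?K" if "is_kernel C k x" "Cod C k = N" for k x
  proof -
    have x: "x \<in> Ar C" "Dom C x = N" using kernelD[OF that(1)] that(2) by auto
    have "subobject_le C m k \<longleftrightarrow> is_zero_arrow C (x \<cdot> f i)" if i: "i \<in> I" and m: "is_image C m (f i)" for i m
      using image_kernel_le[OF m \<open>is_kernel C k x\<close>] x bspec[OF f i] by auto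
    moreover have "\<exists>m. is_image C m (f i)" if "i \<in> I" for i
      using ex_image bspec[OF f that] by auto
    ultimately show ?thesis unfolding opp_annihilated using x by blast
  qed
  show ?thesis
  proof
    assume S: "is_subobject_sum C N ?S l"
    then have "c \<in> ?K" using le[OF l] N unfolding is_subobject_sum_def by blast
    moreover have "is_zero_arrow C (x \<cdot> l)" if x: "x \<in> ?K" for x
    proof -
      have x': "x \<in> Ar C" "Dom C x = N" using x unfolding opp_annihilated by auto
      obtain k where k: "is_kernel C k x" using kernels[OF x'(1)] by blast
      note k' = kernelD[OF k]
      have "is_subobject C N k" using kernel_mono[OF k] k' x' unfolding is_subobject_def by auto
      moreover have "\<forall>m\<in>?S. subobject_le C m k" using le[OF k] x k' x' by simp
      ultimately have "subobject_le C l k" using S unfolding is_subobject_sum_def by blast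
      then obtain u where u: "u \<in> Ar C" "Dom C u = Dom C l" "Cod C u = Dom C k" "k \<cdot> u = l" by (rule subobject_leE)
      have "is_zero_arrow C (x \<cdot> (k \<cdot> u))"
        by (rule comp_zero_left_assoc[OF k'(4)]) (use u(1-3) k' in auto)
      then show ?thesis unfolding u(4) .
    qed
    ultimately show "c \<in> ?K \<and> (\<forall>x\<in>?K. is_zero_arrow C (x \<cdot> l))" by blast
  next
    assume K: "c \<in> ?K \<and> (\<forall>x\<in>?K. is_zero_arrow C (x \<cdot> l))"
    have "subobject_le C l k" if k: "is_subobject C N k" "\<forall>m\<in>?S. subobject_le C m k" for k
    proof -
      have k': "is_mono C k" "Cod C k = N" using k(1) unfolding is_subobject_def by auto
      obtain x where x: "is_kernel C k x" using mono_normal[OF k'(1)] by blast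
      then have "x \<in> ?K" using le[OF x] k' k(2) by blast
      then have "is_zero_arrow C (x \<cdot> l)" using K by blast
      then show ?thesis using kernelD[OF x] l' k' N by (intro kernel_universal[OF x]) auto
    qed
    then show "is_subobject_sum C N ?S l"
      using K le[OF l N] kernel_mono[OF l] N unfolding is_subobject_sum_def is_subobject_def by blast
  qed
qed

lemma mono_kernel_cokernel:
  assumes "is_mono C l"
  obtains c where "is_kernel C l c" "is_cokernel C c l"
proof -
  obtain c where c: "is_cokernel C c l" using cokernels[of l] assms by auto
  note c' = cokernelD[OF c]
  have "is_kernel C l c"
    unfolding is_kernel_def
  proof (intro conjI allI ballI impI c' c'(3)[symmetric])
    fix A h assume h: "h \<in> arrows C A (Dom C c)" "is_zero_arrow C (c \<cdot> h)"
    have "subobject_le C h l" using mono_eq_kernel_of_cokernel[OF assms c] h c' by auto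
    then obtain u where u: "u \<in> Ar C" "Dom C u = Dom C h" "Cod C u = Dom C l" "l \<cdot> u = h" by (rule subobject_leE)
    show "\<exists>!u. u \<in> arrows C A (Dom C l) \<and> l \<cdot> u = h"
    proof (intro ex1I[of _ u] conjI)
      fix v assume v: "v \<in> arrows C A (Dom C l) \<and> l \<cdot> v = h"
      show "v = u" by (rule mono_cancel[OF assms]) (use v u h in auto)
    qed (use u h in auto)
  qed
  then show thesis using that c by blast
qed

text \<open>The quotient by \<open>s\<close> is the complement: \<open>t'\<close> factors as
  \<open>a \<cdot> q\<close>, and \<open>s' \<cdot> a\<close> is the section. Composing it with
  \<open>q\<close> on both sides gives \<open>q\<close> back, and the epimorphism \<open>q\<close>
  cancels.\<close>

lemma splitting_cokernel:
  assumes sp: "splitting N s t s' t'" and q: "is_cokernel C q s"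
  obtains \<sigma> where "\<sigma> \<in> Ar C" "Dom C \<sigma> = Cod C q" "Cod C \<sigma> = N" "q \<cdot> \<sigma> = Idt C (Cod C q)" "\<sigma> \<cdot> q = s' \<cdot> t'"
proof -
  note d = splittingD[OF sp] and q' = cokernelD[OF q]
  obtain a where a: "a \<in> Ar C" "Dom C a = Cod C q" "Cod C a = Cod C t'" "a \<cdot> q = t'"
    using cokernel_universal[OF q _ _ splitting_zero[OF sp]] d by metis
  have "is_zero_arrow C (q \<cdot> (s \<cdot> t))"
    by (rule comp_zero_left_assoc[OF q'(4)]) (use d q' in auto)
  then have "Plus C (q \<cdot> (s \<cdot> t)) (q \<cdot> (s' \<cdot> t')) = q \<cdot> (s' \<cdot> t')"
    by (rule plus_zero) (use d(1-12) q' in auto)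
  then have qe: "q \<cdot> (s' \<cdot> t') = q" using splitting_decomp_right[OF sp q'(2)] q' d by simp
  have "(q \<cdot> (s' \<cdot> a)) \<cdot> q = q \<cdot> (s' \<cdot> t')" using a q' d(1-12) by simp
  also have "\<dots> = Idt C (Cod C q) \<cdot> q" using qe q' by simp
  finally have "q \<cdot> (s' \<cdot> a) = Idt C (Cod C q)"
    using cokernel_epi[OF q] a q' d(1-12) unfolding is_epi_def by auto
  moreover have "(s' \<cdot> a) \<cdot> q = s' \<cdot> t'" using a q' d(1-12) by simp
  ultimately show thesis using that[of "s' \<cdot> a"] a q' d(1-12) by simp
qed

text \<open>\<open>lies_above\<close> speaks of a subobject of a quotient, which is not literally
  \<open>essential_in\<close> read in the opposite category, so it is translated directly. The sum
  \<open>l\<close> becomes its cokernel \<open>c\<close>, the summand becomes its complementary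
  idempotent, and a test subobject of the quotient becomes a quotient of \<open>N\<close> fixed by
  that idempotent.\<close>

lemma lies_above_iff_hull:
  assumes f: "\<forall>i\<in>I. f i \<in> arrows C M N"
  shows "(\<exists>l d. is_subobject_sum C N {m. \<exists>i\<in>I. is_image C m (f i)} l \<and> is_direct_summand C N d \<and>
            (b \<longrightarrow> is_fully_invariant C N d) \<and> lies_above C l d) \<longleftrightarrow>
         (\<exists>e. summand_hull (opp C) N (annihilated (opp C) N (f ` I)) e \<and> (b \<longrightarrow> invariant_idempotent (opp C) N e))"
    (is "?L \<longleftrightarrow> ?R")
proof
  let ?K = "annihilated (opp C) N (f ` I)"
  assume ?L
  then obtain l d where sum: "is_subobject_sum C N {m. \<exists>i\<in>I. is_image C m (f i)} l"
    and ds: "is_direct_summand C N d" and fi: "b \<longrightarrow> is_fully_invariant C N d" and above: "lies_above C l d"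
    by blast
  have l: "is_mono C l" "Cod C l = N" using sum unfolding is_subobject_sum_def is_subobject_def by auto
  have la: "l \<in> Ar C" using l by simp
  obtain c where lc: "is_kernel C l c" and cl: "is_cokernel C c l" using mono_kernel_cokernel[OF l(1)] .
  note c' = cokernelD[OF cl]
  have cK: "c \<in> ?K" and Kl: "\<And>x. x \<in> ?K \<Longrightarrow> is_zero_arrow C (x \<cdot> l)"
    using sum unfolding subobject_sum_images_iff[where I = I and f = f, OF f lc cl l(2)] by auto
  \<comment> \<open>Conversely to \<open>Kl\<close>: an arrow killing \<open>l\<close> factors
    through \<open>c\<close>, which kills every \<open>f i\<close>.\<close>
  have annI: "x \<in> ?K" if xl: "x \<in> Ar C" "Dom C x = N" "is_zero_arrow C (x \<cdot> l)" for x
  proof -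
    obtain u where u: "u \<in> Ar C" "Dom C u = Cod C c" "Cod C u = Cod C x" "u \<cdot> c = x"
      using cokernel_universal[OF cl xl(1)] xl l by auto
    have "is_zero_arrow C (x \<cdot> f i)" if i: "i \<in> I" for i
    proof -
      have "is_zero_arrow C (c \<cdot> f i)" using cK i unfolding opp_annihilated by auto
      then have "is_zero_arrow C (u \<cdot> (c \<cdot> f i))"
        by (rule comp_zero_right) (use u c' bspec[OF f i] l in auto)
      then show ?thesis using comp_cong_left[OF u(4), of "f i"] u(1-3) c' bspec[OF f i] l by simp
    qed
    then show ?thesis unfolding opp_annihilated using xl by auto
  qed
  obtain t s' t' where sp: "splitting N d t s' t'" using ds direct_summand_iff_splitting by blast
  note d = splittingD[OF sp]
  obtain u q p j where u: "u \<in> Ar C" "Dom C u = Dom C d" "Cod C u = Dom C l" "l \<cdot> u = d"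
    and q: "is_cokernel C q d" and p: "is_cokernel C p u"
    and j: "j \<in> Ar C" "Dom C j = Cod C p" "Cod C j = Cod C q" "j \<cdot> p = q \<cdot> l" "is_superfluous C j"
    using above unfolding lies_above_def by (metis in_arrows_iff)
  note q' = cokernelD[OF q] and p' = cokernelD[OF p]
  have "summand_hull (opp C) N ?K (s' \<cdot> t')"
    unfolding opp_summand_hull
  proof (intro conjI allI impI ballI)
    show "s' \<cdot> t' \<in> arrows C N N" using d by simp
    show "(s' \<cdot> t') \<cdot> (s' \<cdot> t') = s' \<cdot> t'" using d(1-12) splitting_retract[OF splitting_sym[OF sp]] by simp
    show "\<exists>m\<in>?K. is_epi C m \<and> (\<forall>x\<in>?K. \<exists>u\<in>arrows C (Cod C m) (Cod C x). u \<cdot> m = x)"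
    proof (intro bexI[OF _ cK] conjI ballI cokernel_epi[OF cl])
      fix x assume x: "x \<in> ?K"
      then have "x \<in> Ar C" "Dom C x = N" unfolding opp_annihilated by auto
      with Kl[OF x] l obtain u where "u \<in> Ar C" "Dom C u = Cod C c" "Cod C u = Cod C x" "u \<cdot> c = x"
        using cokernel_universal[OF cl, of x] by auto
      then show "\<exists>u\<in>arrows C (Cod C c) (Cod C x). u \<cdot> c = x" by auto
    qed
  next
    fix x assume x: "x \<in> ?K"
    then have x': "x \<in> Ar C" "Dom C x = N" unfolding opp_annihilated by auto
    have "is_zero_arrow C (x \<cdot> (l \<cdot> (u \<cdot> t)))"
      by (rule comp_zero_left_assoc[OF Kl[OF x]]) (use u(1-3) la l d(1-12) x' in auto)
    moreover have "l \<cdot> (u \<cdot> t) = d \<cdot> t" using comp_cong_left[OF u(4), of t] u(1-3) la l d(1-12) by simp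
    ultimately have "is_zero_arrow C (x \<cdot> (d \<cdot> t))" by simp
    then have "Plus C (x \<cdot> (d \<cdot> t)) (x \<cdot> (s' \<cdot> t')) = x \<cdot> (s' \<cdot> t')"
      by (rule plus_zero) (use d(1-12) x' in auto)
    then show "x \<cdot> (s' \<cdot> t') = x" using splitting_decomp_right[OF sp x'] by simp
  next
    fix x assume "is_epi C x \<and> Dom C x = N \<and> x \<cdot> (s' \<cdot> t') = x \<and>
      (\<forall>y\<in>Ar C. Dom C y = Cod C x \<and> y \<cdot> x \<in> ?K \<longrightarrow> is_zero_arrow C (y \<cdot> x))"
    then have x: "is_epi C x" "Dom C x = N" "x \<cdot> (s' \<cdot> t') = x"
      and xy: "\<And>y. \<lbrakk>y \<in> Ar C; Dom C y = Cod C x; y \<cdot> x \<in> ?K\<rbrakk> \<Longrightarrow> is_zero_arrow C (y \<cdot> x)" by auto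
    have xa: "x \<in> Ar C" using x by simp
    have "is_zero_arrow C (x \<cdot> (s' \<cdot> (t' \<cdot> d)))"
      using splitting_zero[OF sp] xa x(2) d(1-12) by simp
    moreover have "x \<cdot> (s' \<cdot> (t' \<cdot> d)) = x \<cdot> d"
      using comp_cong_left[OF x(3), of d] xa x(2) d(1-12) by simp
    ultimately have "is_zero_arrow C (x \<cdot> d)" by simp
    then obtain y where y: "y \<in> Ar C" "Dom C y = Cod C q" "Cod C y = Cod C x" "y \<cdot> q = x"
      using cokernel_universal[OF q xa] x(2) d by auto
    interpret op: abelian_category "opp C" by (rule abelian_category_opp)
    have yepi: "is_epi C y" using op.mono_factor[of q y] x(1) y q' by simp
    \<comment> \<open>Superfluity of \<open>j\<close> is applied to the kernel \<open>w\<close> of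
      \<open>y\<close>: once \<open>w\<close> is the whole quotient, \<open>y\<close> vanishes, and
      with it \<open>x = y \<cdot> q\<close>.\<close>
    obtain w where w: "is_kernel C w y" using kernels[OF y(1)] by blast
    note w' = kernelD[OF w]
    have one: "Cod C q \<in> Ob C" using q' by simp
    have "is_subobject_sum C (Cod C j) {j, w} (Idt C (Cod C j))"
      unfolding is_subobject_sum_def is_subobject_def
    proof (intro conjI allI impI ballI, goal_cases)
      case 1 then show ?case using mono_idt one j by simp
    next
      case 2 then show ?case using one j by simp
    next
      case (3 k)
      then have "k \<in> Ar C" "Cod C k = Cod C j" using j w' y by auto
      then show ?case unfolding subobject_le_def using one j by auto
    next
      case (4 z)
      then have z: "is_mono C z" "Cod C z = Cod C q" "subobject_le C j z" "subobject_le C w z" using j by auto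
      \<comment> \<open>To see that \<open>z\<close> is everything, \<open>v\<close> is shown to
        vanish. As \<open>v\<close> kills \<open>w\<close>, it is \<open>g \<cdot> y\<close>; as it
        kills \<open>j\<close>, the arrow \<open>v \<cdot> q = g \<cdot> x\<close> kills
        \<open>l\<close>. The assumption on \<open>x\<close> then makes it zero, and
        \<open>q\<close> is an epimorphism.\<close>
      obtain v where v: "is_kernel C z v" using mono_normal[OF z(1)] by blast
      note v' = kernelD[OF v]
      have kill: "is_zero_arrow C (v \<cdot> k)" if kz: "subobject_le C k z" for k
      proof -
        obtain a where a: "a \<in> Ar C" "Dom C a = Dom C k" "Cod C a = Dom C z" "z \<cdot> a = k"
          using kz by (rule subobject_leE)
        have "is_zero_arrow C (v \<cdot> (z \<cdot> a))" by (rule comp_zero_left_assoc[OF v'(4)]) (use a(1-3) v' in auto)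
        then show ?thesis unfolding a(4) .
      qed
      obtain g where g: "g \<in> Ar C" "Dom C g = Cod C y" "Cod C g = Cod C v" "g \<cdot> y = v"
        using epi_eq_cokernel_of_kernel[OF yepi w v'(1) _ kill[OF z(4)]] v' z y by auto
      have vq: "v \<cdot> q = g \<cdot> x"
        using comp_cong_left[OF g(4), of q] y q' g(1-3) by simp
      have "is_zero_arrow C (v \<cdot> (j \<cdot> p))"
        by (rule comp_zero_left_assoc[OF kill[OF z(3)]]) (use j p' v' z in auto)
      then have "is_zero_arrow C ((v \<cdot> q) \<cdot> l)" unfolding j(4) using v' z q' la l d(1-12) by simp
      then have "g \<cdot> x \<in> ?K" unfolding vq using g y xa x(2) by (intro annI) auto
      then have "is_zero_arrow C (v \<cdot> q)" unfolding vq using xy g y by auto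
      then have "is_zero_arrow C v" by (rule epi_zero[OF cokernel_epi[OF q]]) (use v' z q' d in auto)
      then show ?case using idt_le_kernel_of_zero[OF _ v] z j by simp
    qed
    moreover have "is_subobject C (Cod C j) w" unfolding is_subobject_def using kernel_mono[OF w] w' y j by simp
    ultimately have "subobject_le C (Idt C (Cod C j)) w" using j(5) unfolding is_superfluous_def by blast
    then obtain a where a: "a \<in> Ar C" "Dom C a = Cod C q" "Cod C a = Dom C w" "w \<cdot> a = Idt C (Cod C q)"
      using j one by (auto elim: subobject_leE)
    have "is_zero_arrow C (y \<cdot> (w \<cdot> a))" by (rule comp_zero_left_assoc[OF w'(4)]) (use a(1-3) w' in auto)
    then have "is_zero_arrow C y" unfolding a(4) using y by simp
    then have "is_zero_arrow C (y \<cdot> q)" by (rule comp_zero_left) (use y(1-3) q' in auto)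
    then show "is_zero_arrow C x" unfolding y(4) .
  qed
  then show ?R using fi fully_invariant_iff_opp[OF sp] by blast
next
  let ?K = "annihilated (opp C) N (f ` I)"
  assume ?R
  then obtain e where h: "summand_hull (opp C) N ?K e" and inv: "b \<longrightarrow> invariant_idempotent (opp C) N e" by blast
  have e: "e \<in> Ar C" "Dom C e = N" "Cod C e = N" "e \<cdot> e = e" using summand_hullD(1,2)[OF h] by auto
  \<comment> \<open>The roles are exchanged: \<open>e\<close> projects onto the complement
    \<open>s'\<close>, and the required summand is its kernel \<open>s\<close>.\<close>
  obtain s' t' s t where sp': "splitting N s' t' s t" and st: "s' \<cdot> t' = e" using idempotent_splitting[OF e] .
  have sp: "splitting N s t s' t'" by (rule splitting_sym[OF sp'])
  note d = splittingD[OF sp]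
  obtain c where cK: "c \<in> ?K" and ce: "is_epi C c" and cu: "\<And>x. x \<in> ?K \<Longrightarrow> \<exists>u\<in>arrows C (Cod C c) (Cod C x). u \<cdot> c = x"
    using h unfolding opp_summand_hull by blast
  have c: "c \<in> Ar C" "Dom C c = N" using cK unfolding opp_annihilated by auto
  obtain l where lc: "is_kernel C l c" using kernels[OF c(1)] by blast
  note l' = kernelD[OF lc]
  have lN: "Cod C l = N" using l' c by simp
  have cl: "is_cokernel C c l"
    unfolding is_cokernel_def
  proof (intro conjI allI ballI impI l' l'(3)[symmetric])
    fix B g assume g: "g \<in> arrows C (Cod C l) B" "is_zero_arrow C (g \<cdot> l)"
    obtain y where y: "y \<in> Ar C" "Dom C y = Cod C c" "Cod C y = Cod C g" "y \<cdot> c = g"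
      using epi_eq_cokernel_of_kernel[OF ce lc, of g] g l' by auto
    show "\<exists>!u. u \<in> arrows C (Cod C c) B \<and> u \<cdot> c = g"
    proof (intro ex1I[of _ y] conjI)
      fix v assume "v \<in> arrows C (Cod C c) B \<and> v \<cdot> c = g"
      then show "v = y" using ce y g unfolding is_epi_def by auto
    qed (use y g in auto)
  qed
  have Kl: "is_zero_arrow C (x \<cdot> l)" if xK: "x \<in> ?K" for x
  proof -
    obtain y where y: "y \<in> arrows C (Cod C c) (Cod C x)" "y \<cdot> c = x" using cu[OF xK] by blast
    have "is_zero_arrow C (y \<cdot> (c \<cdot> l))" by (rule comp_zero_right) (use l' y(1) in auto)
    then show ?thesis using comp_cong_left[OF y(2), of l] y(1) l' by simp
  qed
  have sum: "is_subobject_sum C N {m. \<exists>i\<in>I. is_image C m (f i)} l"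
    unfolding subobject_sum_images_iff[where I = I and f = f, OF f lc cl lN] using cK Kl by blast
  \<comment> \<open>Since \<open>c\<close> factors through \<open>e\<close> and \<open>e\<close>
    kills \<open>s\<close>, the summand \<open>s\<close> lies in the kernel \<open>l\<close> of
    \<open>c\<close>.\<close>
  have "c \<cdot> e = c" using h cK unfolding opp_summand_hull by blast
  then have "c \<cdot> s = (c \<cdot> (s' \<cdot> t')) \<cdot> s" unfolding st by simp
  also have "\<dots> = c \<cdot> (s' \<cdot> (t' \<cdot> s))" using c d(1-12) by simp
  finally have "is_zero_arrow C (c \<cdot> s)" using splitting_zero[OF sp] c d(1-12) by simp
  then have "subobject_le C s l" using c d(1-12) by (intro kernel_universal[OF lc]) auto
  then obtain u where u: "u \<in> Ar C" "Dom C u = Dom C s" "Cod C u = Dom C l" "l \<cdot> u = s" by (rule subobject_leE)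
  obtain q where q: "is_cokernel C q s" using cokernels[OF d(1)] by blast
  note q' = cokernelD[OF q]
  obtain \<sigma> where \<sigma>: "\<sigma> \<in> Ar C" "Dom C \<sigma> = Cod C q" "Cod C \<sigma> = N" "q \<cdot> \<sigma> = Idt C (Cod C q)" "\<sigma> \<cdot> q = s' \<cdot> t'"
    using splitting_cokernel[OF sp q] .
  obtain p where p: "is_cokernel C p u" using cokernels[OF u(1)] by blast
  note p' = cokernelD[OF p]
  have "is_zero_arrow C ((q \<cdot> l) \<cdot> u)" using q' l' lN u d(1-12) by simp
  then obtain j where j: "j \<in> Ar C" "Dom C j = Cod C p" "Cod C j = Cod C (q \<cdot> l)" "j \<cdot> p = q \<cdot> l"
    using cokernel_universal[OF p, of "q \<cdot> l"] q' l' lN u d(1-12) by auto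
  have jq: "Cod C j = Cod C q" using j q' l' lN d(1-12) by simp
  have "is_mono C j"
  proof (rule monoI_zero[OF j(1)])
    fix g assume g: "g \<in> Ar C" "Cod C g = Dom C j" "is_zero_arrow C (j \<cdot> g)"
    have tlu: "(t \<cdot> l) \<cdot> u = Idt C (Dom C u)" using u d(1-12) l' lN by simp
    \<comment> \<open>The summand also splits off from the sum, with retraction
      \<open>t \<cdot> l\<close>. The complement \<open>k\<close> of
      \<open>u \<cdot> (t \<cdot> l)\<close> kills \<open>u\<close>, hence factors through
      \<open>p\<close>, and the factor \<open>r\<close> is a section of \<open>p\<close>. It lifts
      \<open>g\<close> to \<open>r \<cdot> g\<close>.\<close>
    obtain k where k: "k \<in> Ar C" "Dom C k = Dom C l" "Cod C k = Dom C l" "Plus C (u \<cdot> (t \<cdot> l)) k = Idt C (Dom C l)"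
      using ex_difference[of "u \<cdot> (t \<cdot> l)" "Idt C (Dom C l)"] u d(1-12) l' lN by auto
    have "Plus C (u \<cdot> ((t \<cdot> l) \<cdot> u)) (k \<cdot> u) = Plus C (u \<cdot> (t \<cdot> l)) k \<cdot> u"
      using u(1-3) d(1-12) l' lN k(1-3) by simp
    also have "\<dots> = u" unfolding k(4) using u l' by simp
    finally have "Plus C u (k \<cdot> u) = u" unfolding tlu using u by simp
    then have "is_zero_arrow C (k \<cdot> u)" by (rule plus_eq_self_imp_zero) (use u k(1-3) in auto)
    then obtain r where r: "r \<in> Ar C" "Dom C r = Cod C p" "Cod C r = Cod C k" "r \<cdot> p = k"
      using cokernel_universal[OF p k(1)] k u by auto
    have "is_zero_arrow C (p \<cdot> (u \<cdot> (t \<cdot> l)))"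
      by (rule comp_zero_left_assoc[OF p'(4)]) (use u(1-3) d(1-12) l' lN p' in auto)
    then have "p \<cdot> k = Plus C (p \<cdot> (u \<cdot> (t \<cdot> l))) (p \<cdot> k)"
      by (rule plus_zero(1)[symmetric]) (use u(1-3) d(1-12) l' lN p' k(1-3) in auto)
    also have "\<dots> = p \<cdot> Plus C (u \<cdot> (t \<cdot> l)) k" using u(1-3) d(1-12) l' lN p' k(1-3) by simp
    also have "\<dots> = p" unfolding k(4) using p' u by simp
    finally have "(p \<cdot> r) \<cdot> p = Idt C (Cod C p) \<cdot> p" using r p' k(1-3) u by simp
    then have pr: "p \<cdot> r = Idt C (Cod C p)"
      using cokernel_epi[OF p] r p' k u unfolding is_epi_def by auto
    have rg: "r \<cdot> g \<in> Ar C" "Cod C (r \<cdot> g) = Dom C l" "Dom C (r \<cdot> g) = Dom C g" using r g j k by auto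
    have prg: "p \<cdot> (r \<cdot> g) = g" using comp_cong_left[OF pr, of g] r g j k p' u by simp
    have jg: "j \<cdot> g = q \<cdot> (l \<cdot> (r \<cdot> g))"
      using comp_cong_left[OF j(4), of "r \<cdot> g"] prg rg j(1,2) p' u q' l' lN d(1-12) by simp
    \<comment> \<open>Applying the section \<open>\<sigma>\<close> shows that the lift has no
      component in the complement. It therefore comes from \<open>u\<close>, which \<open>p\<close>
      kills, so \<open>g = p \<cdot> (r \<cdot> g)\<close> is zero.\<close>
    have "is_zero_arrow C (\<sigma> \<cdot> (q \<cdot> (l \<cdot> (r \<cdot> g))))"
      unfolding jg[symmetric] by (rule comp_zero_right) (use g j jq \<sigma> in auto)
    then have z: "is_zero_arrow C (s' \<cdot> (t' \<cdot> (l \<cdot> (r \<cdot> g))))"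
      using comp_cong_left[OF \<sigma>(5), of "l \<cdot> (r \<cdot> g)"] \<sigma>(1-4) q' l' lN rg d(1-12) by simp
    have "Plus C (s \<cdot> (t \<cdot> (l \<cdot> (r \<cdot> g)))) (s' \<cdot> (t' \<cdot> (l \<cdot> (r \<cdot> g)))) = s \<cdot> (t \<cdot> (l \<cdot> (r \<cdot> g)))"
      by (rule plus_zero(2)[OF z]) (use l' lN rg d(1-12) in auto)
    then have "s \<cdot> (t \<cdot> (l \<cdot> (r \<cdot> g))) = l \<cdot> (r \<cdot> g)"
      using splitting_decomp[OF sp, of "l \<cdot> (r \<cdot> g)"] l' lN rg by simp
    moreover have "l \<cdot> (u \<cdot> (t \<cdot> (l \<cdot> (r \<cdot> g)))) = s \<cdot> (t \<cdot> (l \<cdot> (r \<cdot> g)))"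
      using comp_cong_left[OF u(4), of "t \<cdot> (l \<cdot> (r \<cdot> g))"] u(1-3) l' lN rg d(1-12) by simp
    ultimately have "l \<cdot> (u \<cdot> (t \<cdot> (l \<cdot> (r \<cdot> g)))) = l \<cdot> (r \<cdot> g)" by simp
    then have eq: "u \<cdot> (t \<cdot> (l \<cdot> (r \<cdot> g))) = r \<cdot> g"
      by (rule mono_cancel[OF kernel_mono[OF lc]]) (use u(1-3) l' lN rg d(1-12) in auto)
    have "is_zero_arrow C (p \<cdot> (u \<cdot> (t \<cdot> (l \<cdot> (r \<cdot> g)))))"
      by (rule comp_zero_left_assoc[OF p'(4)]) (use u(1-3) l' lN rg d(1-12) p' in auto)
    then show "is_zero_arrow C g" unfolding eq prg .
  qed
  moreover have "subobject_le C (Idt C (Cod C j)) x"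
    if x: "is_subobject C (Cod C j) x" and jx: "is_subobject_sum C (Cod C j) {j, x} (Idt C (Cod C j))" for x
  proof -
    have x': "is_mono C x" "Cod C x = Cod C q" using x jq unfolding is_subobject_def by auto
    obtain w where xw: "is_kernel C x w" and wx: "is_cokernel C w x" using mono_kernel_cokernel[OF x'(1)] .
    note w' = cokernelD[OF wx]
    interpret op: abelian_category "opp C" by (rule abelian_category_opp)
    have wq: "is_epi C (w \<cdot> q)"
      using op.mono_comp[of w q] cokernel_epi[OF wx] cokernel_epi[OF q] w' x' by simp
    \<comment> \<open>Because \<open>e = \<sigma> \<cdot> q\<close> and \<open>\<sigma>\<close> is a
      section of \<open>q\<close>, already \<open>q\<close> is unchanged by
      \<open>e\<close>.\<close>
    have wqe: "(w \<cdot> q) \<cdot> e = w \<cdot> q"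
      using comp_cong_left[OF \<sigma>(4), of q] \<sigma>(1-3) q' w' x' d(1-12) unfolding st[symmetric] \<sigma>(5)[symmetric] by simp
    have "is_zero_arrow C (w \<cdot> q)"
    proof (rule summand_hullD(5)[OF h, simplified, OF wq])
      show "Dom C (w \<cdot> q) = N" using q' w' x' d(1-12) by simp
      show "(w \<cdot> q) \<cdot> e = w \<cdot> q" by (rule wqe)
      fix y assume y: "y \<in> Ar C" "Dom C y = Cod C (w \<cdot> q)" and yK: "y \<cdot> (w \<cdot> q) \<in> ?K"
      have yw: "Dom C y = Cod C w" using y w' q' x' by simp
      have "is_zero_arrow C ((y \<cdot> (w \<cdot> q)) \<cdot> l)" by (rule Kl[OF yK])
      then have "is_zero_arrow C (((y \<cdot> w) \<cdot> j) \<cdot> p)"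
        using y(1) yw w' q' x' l' lN d(1-12) j jq p' u by simp
      then have z1: "is_zero_arrow C ((y \<cdot> w) \<cdot> j)"
        by (rule epi_zero[OF cokernel_epi[OF p]]) (use y(1) yw w' x' j(1,2) jq p' in auto)
      have z2: "is_zero_arrow C ((y \<cdot> w) \<cdot> x)" using y(1) yw w' x' by simp
      \<comment> \<open>\<open>y \<cdot> w\<close> kills both \<open>j\<close> and \<open>x\<close>,
        so its kernel contains their sum, which is everything; hence \<open>y \<cdot> w\<close> is
        zero.\<close>
      obtain k where k: "is_kernel C k (y \<cdot> w)" using kernels[of "y \<cdot> w"] y(1) yw w' x' by auto
      note k' = kernelD[OF k]
      have "subobject_le C j k" using z1 y(1) yw w' x' j jq by (intro kernel_universal[OF k]) auto
      moreover have "subobject_le C x k" using z2 y(1) yw w' x' j jq by (intro kernel_universal[OF k]) auto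
      moreover have "is_subobject C (Cod C j) k"
        unfolding is_subobject_def using kernel_mono[OF k] k' y(1) yw w' x' jq by simp
      ultimately have "subobject_le C (Idt C (Cod C j)) k" using jx unfolding is_subobject_sum_def by blast
      then obtain a where a: "a \<in> Ar C" "Dom C a = Cod C q" "Cod C a = Dom C k" "k \<cdot> a = Idt C (Cod C q)"
        using jq q' by (auto elim: subobject_leE)
      have "is_zero_arrow C ((y \<cdot> w) \<cdot> (k \<cdot> a))"
        by (rule comp_zero_left_assoc[OF k'(4)]) (use a(1-3) k' in auto)
      then have "is_zero_arrow C (y \<cdot> w)" unfolding a(4) using y(1) yw w' x' by simp
      then have "is_zero_arrow C ((y \<cdot> w) \<cdot> q)" by (rule comp_zero_left) (use y(1) yw w' x' q' in auto)
      then show "is_zero_arrow C (y \<cdot> (w \<cdot> q))" using y(1) yw w' x' q' by simp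
    qed
    then have "is_zero_arrow C w" by (rule epi_zero[OF cokernel_epi[OF q]]) (use w' x' in auto)
    then show ?thesis using idt_le_kernel_of_zero[OF _ xw] x' jq by simp
  qed
  ultimately have "is_superfluous C j" unfolding is_superfluous_def by blast
  then have "lies_above C l s"
    unfolding lies_above_def using u q p j jq by (metis in_arrows_iff)
  moreover have "is_direct_summand C N s" using sp direct_summand_iff_splitting by blast
  moreover have "b \<longrightarrow> is_fully_invariant C N s" using inv fully_invariant_iff_opp[OF sp] st by simp
  ultimately show ?L using sum by blast
qed

text \<open>Arrows from \<open>M\<close> to \<open>N\<close> are arrows from \<open>N\<close> to
  \<open>M\<close> in \<open>opp C\<close>, so the arguments are exchanged on the right.\<close>

lemma dual_CS_Baer_iff:
  fixes \<kappa> :: "'u rel"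
  shows "dual_CS_Baer \<kappa> C M N \<longleftrightarrow> hull_Baer \<kappa> False (opp C) N M"
proof -
  have "(\<exists>l d. is_subobject_sum C N {m. \<exists>i\<in>I. is_image C m (f i)} l \<and> is_direct_summand C N d \<and> lies_above C l d) \<longleftrightarrow>
    (\<exists>e. summand_hull (opp C) N (annihilated (opp C) N (f ` I)) e)" if "\<forall>i\<in>I. f i \<in> arrows C M N" for I :: "'u set" and f
    using lies_above_iff_hull[of I f M N False] that by auto
  then show ?thesis unfolding dual_CS_Baer_def hull_Baer_def opp_arrows simp_thms
    by (intro iff_allI imp_cong refl) blast
qed

lemma dual_strongly_CS_Baer_iff:
  fixes \<kappa> :: "'u rel"
  shows "dual_strongly_CS_Baer \<kappa> C M N \<longleftrightarrow> hull_Baer \<kappa> True (opp C) N M"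
proof -
  have "(\<exists>l d. is_subobject_sum C N {m. \<exists>i\<in>I. is_image C m (f i)} l \<and> is_direct_summand C N d \<and>
      is_fully_invariant C N d \<and> lies_above C l d) \<longleftrightarrow>
    (\<exists>e. summand_hull (opp C) N (annihilated (opp C) N (f ` I)) e \<and> invariant_idempotent (opp C) N e)"
    if "\<forall>i\<in>I. f i \<in> arrows C M N" for I :: "'u set" and f
    using lies_above_iff_hull[of I f M N True] that by auto
  then show ?thesis unfolding dual_strongly_CS_Baer_def hull_Baer_def opp_arrows simp_thms
    by (intro iff_allI imp_cong refl) blast
qed

end

theorem theorem8p4:
  fixes C :: "('o, 'a) additive_category_data" and \<kappa> :: "'u rel" and n :: nat
  assumes "abelian_category C"
    and "Cinfinite \<kappa>" and "locally_small \<kappa> C"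
    and "n \<ge> 1"
  shows
    "(AB3_star \<kappa> C \<longrightarrow>
       (\<forall>M N S \<iota> \<pi>. M \<in> Ob C \<and> (\<forall>i\<in>{1..n}. N i \<in> Ob C) \<and> is_direct_sum C {1..n} N S \<iota> \<pi> \<longrightarrow>
          (CS_Baer \<kappa> C M S \<longleftrightarrow> (\<forall>i\<in>{1..n}. CS_Baer \<kappa> C M (N i))) \<and>
          (strongly_CS_Baer \<kappa> C M S \<longleftrightarrow> (\<forall>i\<in>{1..n}. strongly_CS_Baer \<kappa> C M (N i))))) \<and>
     (AB3 \<kappa> C \<longrightarrow>
       (\<forall>N M S \<iota> \<pi>. N \<in> Ob C \<and> (\<forall>i\<in>{1..n}. M i \<in> Ob C) \<and> is_direct_sum C {1..n} M S \<iota> \<pi> \<longrightarrow>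
          (dual_CS_Baer \<kappa> C S N \<longleftrightarrow> (\<forall>i\<in>{1..n}. dual_CS_Baer \<kappa> C (M i) N)) \<and>
          (dual_strongly_CS_Baer \<kappa> C S N \<longleftrightarrow> (\<forall>i\<in>{1..n}. dual_strongly_CS_Baer \<kappa> C (M i) N))))"
proof -
  interpret abelian_category C by (rule assms(1))
  interpret op: abelian_category "opp C" by (rule abelian_category_opp)
  have direct: "hull_Baer \<kappa> b C M S \<longleftrightarrow> (\<forall>i\<in>{1..n}. hull_Baer \<kappa> b C M (X i))"
    if "M \<in> Ob C" "is_direct_sum C {1..n} X S \<iota> \<pi>" for b M X S \<iota> \<pi>
    by (rule hull_Baer_direct_sum[OF that(2,1)])
  \<comment> \<open>Exchanging injections and projections makes the biproduct of \<open>C\<close>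
    one of \<open>opp C\<close>, so a direct sum of sources becomes a direct sum of targets.\<close>
  have dual: "hull_Baer \<kappa> b (opp C) N S \<longleftrightarrow> (\<forall>i\<in>{1..n}. hull_Baer \<kappa> b (opp C) N (X i))"
    if "N \<in> Ob C" "is_direct_sum C {1..n} X S \<iota> \<pi>" for b N X S \<iota> \<pi>
    by (rule op.hull_Baer_direct_sum[OF opp_is_direct_sum[OF that(2)]]) (use that(1) in simp)
  show ?thesis
    unfolding CS_Baer_iff strongly_CS_Baer_iff dual_CS_Baer_iff dual_strongly_CS_Baer_iff
    by (intro conjI allI impI; elim conjE) (rule direct dual, assumption, assumption)+
qed

end
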